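(* Let $n\ge 2$, $p>1$, $\Omega\subset\mathbb{R}^n$ a bounded open set, $\{w_1,w_2,\dots\}$ a Schauder basis of $W^{1,p}_0(\Omega)$, and $m\ge 1$. Let $F:(\mathbb{R}^m,\|\cdot\|_{1,p,m})\to(\mathbb{R}^m,\|\cdot\|_{1,p,m})$ be continuous, and suppose there is $\varrho>0$ such that $\langle F(\zeta),\zeta\rangle\ge 0$ for every $\zeta\in\mathbb{R}^m$ with $\lfloor\zeta\rfloor_m=\varrho$. Then there exists $z_0$ in the closed affine ball $\overline{B}^m_\varrho(0)=\{z\in\mathbb{R}^m:\lfloor z\rfloor_m\le\varrho\}$ such that $F(z_0)=0$.
   Context: For $u\in W^{1,p}_0(\Omega)$ and $\xi\in\mathbb{S}^{n-1}$, $\nabla_\xi u=\nabla u\cdot\xi$. The affine $L^p$ energy is $\mathcal{E}_{p,\Omega}(u)=\gamma_{n,p}\left(\int_{\mathbb{S}^{n-1}}\|\nabla_\xi u\|_{L^p(\Omega)}^{-n}\,d\sigma(\xi)\right)^{-1/n}$, where $\sigma$ is the surface measure on $\mathbb{S}^{n-1}$, $\gamma_{n,p}=(2\omega_{n+p-2})^{-1}(n\omega_n\omega_{p-1})(n\omega_n)^{p/n}$, $\omega_\kappa$ is the volume of the unit Euclidean ball in $\mathbb{R}^\kappa$ (extended to real $\kappa$ via the Gamma function), and $\mathcal{E}_{p,\Omega}(0)=0$. For $\zeta=(\zeta_1,\dots,\zeta_m)\in\mathbb{R}^m$ set $\lfloor\zeta\rfloor_m=\mathcal{E}_{p,\Omega}\big(\sum_{j=1}^m\zeta_jw_j\big)$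 (this is not a norm) and $\|\zeta\|_{1,p,m}=\big\|\sum_{j=1}^m\zeta_jw_j\big\|_{W^{1,p}_0(\Omega)}$, which is a norm on $\mathbb{R}^m$. $\langle\cdot,\cdot\rangle$ is the Euclidean inner product on $\mathbb{R}^m$, with $\langle x,x\rangle^{1/2}=|x|_2$. *)

theory Defs
  imports "HOL-Analysis.Analysis"
begin

definition partial_deriv :: "(real^'n \<Rightarrow> real) \<Rightarrow> 'n \<Rightarrow> real^'n \<Rightarrow> real" where
  "partial_deriv f i x = frechet_derivative f (at x) (axis i 1)"

definition grad :: "(real^'n \<Rightarrow> real) \<Rightarrow> real^'n \<Rightarrow> real^'n" where
  "grad f x = (\<chi> i. partial_deriv f i x)"

text \<open>C-infinity functions: differentiable everywhere, and all partial derivatives are again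
  C-infinity (coinductively, i.e. partial derivatives of every order exist).\<close>
coinductive smooth_fun :: "(real^'n \<Rightarrow> real) \<Rightarrow> bool" where
  "(\<forall>x. f differentiable (at x)) \<Longrightarrow> (\<forall>i. smooth_fun (partial_deriv f i)) \<Longrightarrow> smooth_fun f"

definition test_fun :: "(real^'n) set \<Rightarrow> (real^'n \<Rightarrow> real) \<Rightarrow> bool" where
  "test_fun \<Omega> \<phi> \<longleftrightarrow> smooth_fun \<phi> \<and> compact (closure {x. \<phi> x \<noteq> 0})
      \<and> closure {x. \<phi> x \<noteq> 0} \<subseteq> \<Omega>"

definition Lp_int :: "(real^'n) set \<Rightarrow> real \<Rightarrow> (real^'n \<Rightarrow> real) \<Rightarrow> ennreal" where
  "Lp_int \<Omega> p f = (\<integral>\<^sup>+ x\<in>\<Omega>. ennreal (\<bar>f x\<bar> powr p) \<partial>lebesgue)"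

definition Lp_norm :: "(real^'n) set \<Rightarrow> real \<Rightarrow> (real^'n \<Rightarrow> real) \<Rightarrow> real" where
  "Lp_norm \<Omega> p f = enn2real (Lp_int \<Omega> p f) powr (1 / p)"

text \<open>u belongs to W^{1,p}_0(Omega) with (weak) gradient G: u and G are measurable,
  p-integrable on Omega, and u is the W^{1,p}-limit of test functions (closure of
  C_c^infinity(Omega) in the W^{1,p} norm).\<close>
definition W0_grad :: "(real^'n) set \<Rightarrow> real \<Rightarrow> (real^'n \<Rightarrow> real) \<Rightarrow> (real^'n \<Rightarrow> real^'n) \<Rightarrow> bool" where
  "W0_grad \<Omega> p u G \<longleftrightarrow>
     u \<in> borel_measurable lebesgue \<and> G \<in> borel_measurable lebesgue \<and>
     Lp_int \<Omega> p u < \<infinity> \<and> Lp_int \<Omega> p (\<lambda>x. norm (G x)) < \<infinity> \<and>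
     (\<exists>\<phi> :: nat \<Rightarrow> real^'n \<Rightarrow> real. (\<forall>k. test_fun \<Omega> (\<phi> k)) \<and>
        ((\<lambda>k. Lp_int \<Omega> p (\<lambda>x. \<phi> k x - u x)) \<longlongrightarrow> 0) sequentially \<and>
        ((\<lambda>k. Lp_int \<Omega> p (\<lambda>x. norm (grad (\<phi> k) x - G x))) \<longlongrightarrow> 0) sequentially)"

definition W0 :: "(real^'n) set \<Rightarrow> real \<Rightarrow> (real^'n \<Rightarrow> real) set" where
  "W0 \<Omega> p = {u. \<exists>G. W0_grad \<Omega> p u G}"

text \<open>The (weak) gradient of u in W^{1,p}_0 (unique a.e. on Omega).\<close>
definition wgrad :: "(real^'n) set \<Rightarrow> real \<Rightarrow> (real^'n \<Rightarrow> real) \<Rightarrow> real^'n \<Rightarrow> real^'n" where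
  "wgrad \<Omega> p u = (SOME G. W0_grad \<Omega> p u G)"

definition W_norm :: "(real^'n) set \<Rightarrow> real \<Rightarrow> (real^'n \<Rightarrow> real) \<Rightarrow> real" where
  "W_norm \<Omega> p u = (enn2real (Lp_int \<Omega> p u)
      + enn2real (Lp_int \<Omega> p (\<lambda>x. norm (wgrad \<Omega> p u x)))) powr (1 / p)"

text \<open>Schauder basis of W^{1,p}_0(Omega), indexed from 0 (w 0 is w_1 of the paper).\<close>
definition schauder_basis :: "(real^'n) set \<Rightarrow> real \<Rightarrow> (nat \<Rightarrow> real^'n \<Rightarrow> real) \<Rightarrow> bool" where
  "schauder_basis \<Omega> p w \<longleftrightarrow> (\<forall>j. w j \<in> W0 \<Omega> p) \<and>
     (\<forall>u\<in>W0 \<Omega> p. \<exists>!c :: nat \<Rightarrow> real.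
        ((\<lambda>N. W_norm \<Omega> p (\<lambda>x. u x - (\<Sum>j<N. c j * w j x))) \<longlongrightarrow> 0) sequentially)"

definition omega_vol :: "real \<Rightarrow> real" where
  "omega_vol \<kappa> = pi powr (\<kappa> / 2) / Gamma (\<kappa> / 2 + 1)"

definition gamma_np :: "nat \<Rightarrow> real \<Rightarrow> real" where
  "gamma_np n p = inverse (2 * omega_vol (real n + p - 2)) * (real n * omega_vol n * omega_vol (p - 1))
      * (real n * omega_vol n) powr (p / real n)"

text \<open>Integral over the unit sphere S^{n-1} with respect to surface measure, expressed by
  polar coordinates: int_S f dsigma = n * int_{B_1} f(x/|x|) dx.\<close>
definition sphere_nn_integral :: "(real^'n \<Rightarrow> ennreal) \<Rightarrow> ennreal" where
  "sphere_nn_integral f = ennreal (real CARD('n)) *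
     (\<integral>\<^sup>+ x\<in>ball 0 1. f (x /\<^sub>R norm x) \<partial>lebesgue)"

definition affine_energy :: "(real^'n) set \<Rightarrow> real \<Rightarrow> (real^'n \<Rightarrow> real) \<Rightarrow> real" where
  "affine_energy \<Omega> p u =
     (let I = sphere_nn_integral (\<lambda>\<xi>::real^'n.
                 let a = Lp_norm \<Omega> p (\<lambda>x. wgrad \<Omega> p u x \<bullet> \<xi>)
                 in if a = 0 then \<infinity> else ennreal (a powr (- real CARD('n))))
      in if u = (\<lambda>x. 0) \<or> I = \<infinity> then 0
         else gamma_np CARD('n) p * enn2real I powr (- 1 / real CARD('n)))"

definition Rm :: "nat \<Rightarrow> (nat \<Rightarrow> real) set" where
  "Rm m = {\<zeta>. \<forall>j\<ge>m. \<zeta> j = 0}"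

definition combo :: "(nat \<Rightarrow> real^'n \<Rightarrow> real) \<Rightarrow> nat \<Rightarrow> (nat \<Rightarrow> real) \<Rightarrow> real^'n \<Rightarrow> real" where
  "combo w m \<zeta> = (\<lambda>x. \<Sum>j<m. \<zeta> j * w j x)"

definition affine_floor :: "(real^'n) set \<Rightarrow> real \<Rightarrow> (nat \<Rightarrow> real^'n \<Rightarrow> real) \<Rightarrow> nat \<Rightarrow> (nat \<Rightarrow> real) \<Rightarrow> real" where
  "affine_floor \<Omega> p w m \<zeta> = affine_energy \<Omega> p (combo w m \<zeta>)"

definition norm_1pm :: "(real^'n) set \<Rightarrow> real \<Rightarrow> (nat \<Rightarrow> real^'n \<Rightarrow> real) \<Rightarrow> nat \<Rightarrow> (nat \<Rightarrow> real) \<Rightarrow> real" where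
  "norm_1pm \<Omega> p w m \<zeta> = W_norm \<Omega> p (combo w m \<zeta>)"

definition inner_m :: "nat \<Rightarrow> (nat \<Rightarrow> real) \<Rightarrow> (nat \<Rightarrow> real) \<Rightarrow> real" where
  "inner_m m x y = (\<Sum>j<m. x j * y j)"

end

theory Submission
  imports Defs "HOL-Homology.Homology"
begin

text \<open>
  Poincare's inequality in a single direction shows that a nonzero function of \<open>W\<^sup>1\<^sup>,\<^sup>p\<^sub>0(\<Omega>)\<close> has no
  vanishing directional derivative. Hence the directional norms of \<open>\<Sum> \<zeta>\<^sub>j w\<^sub>j\<close>
  are continuous and bounded below for \<open>\<zeta>\<close> and \<open>\<xi>\<close> on the unit spheres, so that the affine energy,
  although not a norm, is positive, continuous and homogeneous of degree one on \<open>\<real>\<^sup>m\<close> minus the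
  origin. Its ball of radius \<open>\<rho>\<close> is therefore a compact star body with continuous radial function, and
  a vector field pointing weakly outwards on the boundary of such a body has a zero because the sphere
  is not contractible.
\<close>

section \<open>Test functions\<close>

text \<open>What survives is that every ray from the origin meets the boundary exactly once;
  rescaling along rays turns the hypothesis on \<open>F\<close> into a sign condition indexed by the
  Euclidean unit sphere. Two conventions in the definitions shape the analysis. The energy is set to
  0 when the integral over directions is infinite, so a nonzero combination with too small
  directional norms would have energy 0 and its whole line would lie in the ball; a lower bound
  uniform in all directions excludes this and also supplies the dominating function for continuity.
  And \<open>wgrad\<close> is chosen separately for each function, so it is linear in the
  coefficients only up to null sets, and only once weak gradients are known to be unique. Facts
  about weak gradients are derived from L1 convergence, which Lp convergence implies because
  \<Omega> is bounded. Linear independence of the basis functions is the uniqueness of the Schauder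
  expansion of the zero function.\<close>

lemma smooth_fun_differentiable: "smooth_fun f \<Longrightarrow> f differentiable (at x)"
  by (erule smooth_fun.cases) auto

lemma smooth_fun_partial: "smooth_fun f \<Longrightarrow> smooth_fun (partial_deriv f i)"
  by (erule smooth_fun.cases) auto

lemma smooth_fun_continuous: "smooth_fun f \<Longrightarrow> continuous_on S f"
  by (meson continuous_at_imp_continuous_on differentiable_imp_continuous_within smooth_fun_differentiable)

lemma grad_eqI:
  assumes "(f has_derivative (\<lambda>v. g \<bullet> v)) (at x)"
  shows "grad f x = g"
proof -
  have "frechet_derivative f (at x) = (\<lambda>v. g \<bullet> v)"
    using frechet_derivative_at[OF assms] by simp
  then show ?thesis by (simp add: grad_def partial_deriv_def vec_eq_iff inner_axis)
qed

lemma has_derivative_grad: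
  assumes "f differentiable (at x)"
  shows "(f has_derivative (\<lambda>v. grad f x \<bullet> v)) (at x)"
proof -
  let ?D = "frechet_derivative f (at x)"
  have D: "(f has_derivative ?D) (at x)" using assms frechet_derivative_works by blast
  then interpret bounded_linear ?D by (rule has_derivative_bounded_linear)
  have "?D v = grad f x \<bullet> v" for v
  proof -
    have "?D v = ?D (\<Sum>i\<in>UNIV. v $ i *\<^sub>R axis i 1)" by (simp add: basis_expansion flip: scalar_mult_eq_scaleR)
    also have "\<dots> = (\<Sum>i\<in>UNIV. v $ i * ?D (axis i 1))" by (simp add: sum scaleR)
    also have "\<dots> = grad f x \<bullet> v"
      by (simp add: grad_def partial_deriv_def inner_vec_def mult.commute)
    finally show ?thesis .
  qed
  then have "?D = (\<lambda>v. grad f x \<bullet> v)" by auto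
  then show ?thesis using D by simp
qed

lemma smooth_fun_grad_continuous:
  assumes "smooth_fun f" shows "continuous_on S (grad f)"
  unfolding grad_def
  by (intro continuous_on_vec_lambda smooth_fun_continuous smooth_fun_partial assms)

lemma grad_lincomb:
  assumes "f differentiable (at x)" "g differentiable (at x)"
  shows "grad (\<lambda>x. a * f x + b * g x) x = a *\<^sub>R grad f x + b *\<^sub>R grad g x"
proof (rule grad_eqI)
  show "((\<lambda>x. a * f x + b * g x) has_derivative
      (\<bullet>) (a *\<^sub>R grad f x + b *\<^sub>R grad g x)) (at x)"
    using has_derivative_grad[OF assms(1)] has_derivative_grad[OF assms(2)]
    by (auto intro!: derivative_eq_intros simp: inner_add_left)
qed

text \<open>Coinduction over the set of all combinations with these fixed coefficients
  \<open>a\<close> and \<open>b\<close>: differentiating such a combination gives the combination of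
  the partial derivatives, which lies in the same set.\<close>

lemma smooth_fun_lincomb:
  fixes f g :: "real^'n \<Rightarrow> real"
  assumes "smooth_fun f" "smooth_fun g"
  shows "smooth_fun (\<lambda>x. a * f x + b * g x)"
proof -
  have "\<exists>f g. h = (\<lambda>x. a * f x + b * g x) \<and> smooth_fun f \<and> smooth_fun g \<Longrightarrow> smooth_fun h"
    for h :: "real^'n \<Rightarrow> real"
  proof (coinduction arbitrary: h rule: smooth_fun.coinduct)
    case smooth_fun
    then obtain f g where h: "h = (\<lambda>x. a * f x + b * g x)" and f: "smooth_fun f" and g: "smooth_fun g"
      by blast
    have d: "h differentiable (at x)" for x
      unfolding h by (intro differentiable_add differentiable_mult differentiable_const
          smooth_fun_differentiable f g)
    have "partial_deriv h i = (\<lambda>x. a * partial_deriv f i x + b * partial_deriv g i x)" for i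
    proof
      fix x
      show "partial_deriv h i x = a * partial_deriv f i x + b * partial_deriv g i x"
        using arg_cong[OF grad_lincomb[of f x g a b], of "\<lambda>v. v $ i"]
          smooth_fun_differentiable f g by (auto simp: grad_def h)
    qed
    then show ?case using d f g smooth_fun_partial by blast
  qed
  then show ?thesis using assms by blast
qed

lemma test_fun_lincomb:
  assumes "test_fun \<Omega> f" "test_fun \<Omega> g"
  shows "test_fun \<Omega> (\<lambda>x. a * f x + b * g x)"
proof -
  let ?S = "closure {x. f x \<noteq> 0} \<union> closure {x. g x \<noteq> 0}"
  have S: "compact ?S" "?S \<subseteq> \<Omega>" using assms by (auto simp: test_fun_def)
  have "closure {x. a * f x + b * g x \<noteq> 0} \<subseteq> closure ({x. f x \<noteq> 0} \<union> {x. g x \<noteq> 0})"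
    by (intro closure_mono) auto
  then have sub: "closure {x. a * f x + b * g x \<noteq> 0} \<subseteq> ?S" by (simp add: closure_Un)
  then have "compact (closure {x. a * f x + b * g x \<noteq> 0})"
    using compact_Int_closed[OF S(1) closed_closure, of "{x. a * f x + b * g x \<noteq> 0}"] sub by (simp add: Int_absorb1)
  then show ?thesis using assms sub S smooth_fun_lincomb unfolding test_fun_def by blast
qed

lemma smooth_fun_zero: "smooth_fun (\<lambda>x::real^'n. 0)"
proof -
  have g0: "grad (\<lambda>x::real^'n. 0) x = 0" for x by (rule grad_eqI) simp
  have p0: "partial_deriv (\<lambda>x::real^'n. 0) i = (\<lambda>x. 0)" for i
    using g0 by (auto simp: grad_def vec_eq_iff)
  have "h = (\<lambda>x::real^'n. 0) \<Longrightarrow> smooth_fun h" for h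
    by (coinduction arbitrary: h rule: smooth_fun.coinduct) (simp add: p0)
  then show ?thesis by simp
qed

lemma test_fun_zero: "test_fun \<Omega> (\<lambda>x. 0)"
  by (simp add: test_fun_def smooth_fun_zero)

lemma test_fun_eq_0:
  assumes "test_fun \<Omega> f" "x \<notin> \<Omega>" shows "f x = 0"
  using assms closure_subset[of "{x. f x \<noteq> 0}"] unfolding test_fun_def by blast

lemma test_fun_grad_eq_0:
  fixes f :: "real^'n \<Rightarrow> real"
  assumes "test_fun \<Omega> f" "x \<notin> closure {x. f x \<noteq> 0}" shows "grad f x = 0"
proof -
  have "((\<lambda>x. 0) has_derivative (\<lambda>v. (0::real^'n) \<bullet> v)) (at x)" by simp
  then have "(f has_derivative (\<lambda>v. 0 \<bullet> v)) (at x)"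
    by (rule has_derivative_transform_within_open[of _ _ _ _ "- closure {x. f x \<noteq> 0}"])
      (use assms closure_subset[of "{x. f x \<noteq> 0}"] in auto)
  then show ?thesis by (rule grad_eqI)
qed

lemma test_fun_grad_eq_0':
  assumes "test_fun \<Omega> f" "x \<notin> \<Omega>" shows "grad f x = 0"
  by (rule test_fun_grad_eq_0[OF assms(1)]) (use assms in \<open>auto simp: test_fun_def\<close>)

lemma test_fun_grad_bounded:
  assumes "test_fun \<Omega> f"
  obtains B where "B > 0" "\<And>x. norm (grad f x) \<le> B"
proof -
  have "compact (grad f ` closure {x. f x \<noteq> 0})"
    using assms by (intro compact_continuous_image smooth_fun_grad_continuous) (auto simp: test_fun_def)
  then obtain B where B: "B > 0" "\<forall>y\<in>grad f ` closure {x. f x \<noteq> 0}. norm y \<le> B"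
    using bounded_pos compact_imp_bounded by metis
  have "norm (grad f x) \<le> B" for x
    using B test_fun_grad_eq_0[OF assms, of x] by (cases "x \<in> closure {x. f x \<noteq> 0}") auto
  then show ?thesis using B that by blast
qed

lemma test_fun_lipschitz:
  fixes f :: "real^'n \<Rightarrow> real"
  assumes "test_fun \<Omega> f" "\<And>x. norm (grad f x) \<le> B"
  shows "\<bar>f (x + v) - f x\<bar> \<le> B * norm v"
proof -
  have "norm (f (x + v) - f x) \<le> B * norm (x + v - x)"
  proof (rule differentiable_bound[of UNIV])
    fix y :: "real^'n"
    show "(f has_derivative (\<lambda>v. grad f y \<bullet> v)) (at y within UNIV)"
      using assms by (auto simp: test_fun_def smooth_fun_differentiable intro!: has_derivative_grad)
    show "onorm (\<lambda>v. grad f y \<bullet> v) \<le> B"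
    proof (rule onorm_le)
      fix v
      have "norm (grad f y \<bullet> v) \<le> norm (grad f y) * norm v"
        using Cauchy_Schwarz_ineq2 by simp
      also have "\<dots> \<le> B * norm v" by (intro mult_right_mono assms) simp
      finally show "norm (grad f y \<bullet> v) \<le> B * norm v" .
    qed
  qed auto
  then show ?thesis by simp
qed

section \<open>Difference quotients\<close>

lemma lborel_integral_translation:
  fixes f :: "'a::euclidean_space \<Rightarrow> real"
  assumes [measurable]: "f \<in> borel_measurable borel"
  shows "(\<integral>x. f (x + c) \<partial>lborel) = (\<integral>x. f x \<partial>lborel)"
proof -
  have "(\<integral>x. f x \<partial>lborel) = (\<integral>x. f x \<partial>distr lborel borel ((+) c))"
    by (simp add: lborel_distr_plus)
  also have "\<dots> = (\<integral>x. f (c + x) \<partial>lborel)"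
    by (rule integral_distr) simp_all
  finally show ?thesis by (simp add: add.commute)
qed

lemma lborel_integrable_translation:
  fixes f :: "'a::euclidean_space \<Rightarrow> real"
  assumes "integrable lborel f"
  shows "integrable lborel (\<lambda>x. f (x + c))"
proof -
  have [measurable]: "f \<in> borel_measurable borel" using assms by auto
  have "integrable (distr lborel borel ((+) c)) f" using assms by (simp add: lborel_distr_plus)
  then have "integrable lborel (\<lambda>x. f (c + x))" by (subst (asm) integrable_distr_eq) simp_all
  then show ?thesis by (simp add: add.commute)
qed

lemma integrable_continuous_bounded_support:
  fixes f :: "'a::euclidean_space \<Rightarrow> real"
  assumes "continuous_on UNIV f" "bounded \<Omega>" "\<And>x. x \<notin> \<Omega> \<Longrightarrow> f x = 0"
  shows "integrable lborel f"
proof -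
  have "integrable lborel (\<lambda>x. indicator (closure \<Omega>) x *\<^sub>R f x)"
    using assms by (intro borel_integrable_compact continuous_on_subset[OF assms(1)]) auto
  also have "(\<lambda>x. indicator (closure \<Omega>) x *\<^sub>R f x) = f"
    using assms(3) closure_subset[of \<Omega>] by (fastforce simp: indicator_def)
  finally show ?thesis .
qed

lemma test_fun_continuous: "test_fun \<Omega> f \<Longrightarrow> continuous_on S f"
  by (simp add: test_fun_def smooth_fun_continuous)

lemma test_fun_grad_continuous: "test_fun \<Omega> f \<Longrightarrow> continuous_on S (grad f)"
  by (simp add: test_fun_def smooth_fun_grad_continuous)

lemma test_fun_integrable:
  assumes "test_fun \<Omega> f" "bounded \<Omega>"
  shows "integrable lborel f" "integrable lborel (\<lambda>x. grad f x \<bullet> v)"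
  using test_fun_eq_0[OF assms(1)] test_fun_grad_eq_0'[OF assms(1)]
  by (auto intro!: integrable_continuous_bounded_support[OF _ assms(2)] continuous_on_inner
      continuous_on_const test_fun_continuous[OF assms(1)] test_fun_grad_continuous[OF assms(1)])

text \<open>The step is \<open>v\<close> divided by \<open>Suc N\<close>: it is defined for every
  \<open>N\<close>, and \<open>Suc N\<close> steps add up to exactly \<open>v\<close>, as the
  telescoping argument for the directional Poincare inequality requires.\<close>

definition diff_quot :: "('a::real_vector \<Rightarrow> real) \<Rightarrow> 'a \<Rightarrow> nat \<Rightarrow> 'a \<Rightarrow> real" where
  "diff_quot f v N x = real (Suc N) * (f (x + v /\<^sub>R real (Suc N)) - f x)"

lemma diff_quot_tendsto:
  assumes "f differentiable (at x)"
  shows "(\<lambda>N. diff_quot f v N x) \<longlonglongrightarrow> grad f x \<bullet> v"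
\<comment> \<open>For \<open>v = 0\<close> the increments never leave the origin, so the limit along
  the punctured filter \<open>at 0\<close> does not apply; both sides are 0 anyway.\<close>
proof (cases "v = 0")
  case True
  then show ?thesis by (simp add: diff_quot_def)
next
  case False
  have "(\<lambda>h. norm (f (x + h) - f x - grad f x \<bullet> h) / norm h) \<midarrow>0\<rightarrow> 0"
    using has_derivative_grad[OF assms] by (auto simp: has_derivative_at)
  moreover have "filterlim (\<lambda>N. v /\<^sub>R real (Suc N)) (at 0) sequentially"
  proof -
    have "(\<lambda>N. inverse (real (Suc N)) *\<^sub>R v) \<longlonglongrightarrow> 0 *\<^sub>R v"
      by (intro tendsto_intros LIMSEQ_inverse_real_of_nat)
    then show ?thesis using False by (auto simp: filterlim_at)
  qed
  ultimately have "(\<lambda>N. norm (f (x + v /\<^sub>R real (Suc N)) - f x - grad f x \<bullet> (v /\<^sub>R real (Suc N)))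
      / norm (v /\<^sub>R real (Suc N))) \<longlonglongrightarrow> 0"
    by (rule filterlim_compose)
  then have "(\<lambda>N. norm v * (norm (f (x + v /\<^sub>R real (Suc N)) - f x - grad f x \<bullet> (v /\<^sub>R real (Suc N)))
      / norm (v /\<^sub>R real (Suc N)))) \<longlonglongrightarrow> norm v * 0"
    by (intro tendsto_intros)
  moreover have "norm v * (norm (f (x + v /\<^sub>R real (Suc N)) - f x - grad f x \<bullet> (v /\<^sub>R real (Suc N)))
      / norm (v /\<^sub>R real (Suc N))) = \<bar>diff_quot f v N x - grad f x \<bullet> v\<bar>" for N
  proof -
    have c: "real (Suc N) * (inverse (real (Suc N)) * c) = c" for c
      by (simp add: mult.assoc[symmetric] del: of_nat_Suc)
    have "\<bar>diff_quot f v N x - grad f x \<bullet> v\<bar>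
        = \<bar>real (Suc N) * (f (x + v /\<^sub>R real (Suc N)) - f x - grad f x \<bullet> (v /\<^sub>R real (Suc N)))\<bar>"
      by (simp add: diff_quot_def right_diff_distrib inner_scaleR_right c del: of_nat_Suc)
    also have "\<dots> = real (Suc N) * \<bar>f (x + v /\<^sub>R real (Suc N)) - f x - grad f x \<bullet> (v /\<^sub>R real (Suc N))\<bar>"
      by (simp add: abs_mult del: of_nat_Suc)
    finally show ?thesis using False by (simp add: field_simps del: of_nat_Suc)
  qed
  ultimately have "(\<lambda>N. \<bar>diff_quot f v N x - grad f x \<bullet> v\<bar>) \<longlonglongrightarrow> 0" by simp
  then show ?thesis using Lim_null tendsto_rabs_zero_iff by blast
qed

lemma diff_quot_dominated:
  fixes f :: "real^'n \<Rightarrow> real"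
  assumes f: "test_fun \<Omega> f" "bounded \<Omega>"
  obtains w where "integrable lborel w" "\<And>N x. \<bar>diff_quot f v N x\<bar> \<le> w x"
proof -
  obtain B where B: "B > 0" "\<And>x. norm (grad f x) \<le> B" using test_fun_grad_bounded[OF f(1)] by blast
  obtain R where R: "\<And>x. x \<in> \<Omega> \<Longrightarrow> norm x \<le> R" using f(2) by (auto simp: bounded_iff)
  \<comment> \<open>All difference quotients vanish off this ball, because there both
    \<open>x\<close> and its translate by at most \<open>norm v\<close> are outside \<Omega>. On the
    ball they are bounded by \<open>B * norm v\<close>, as \<open>B\<close> is a Lipschitz constant
    of \<open>f\<close>.\<close>
  define w where "w x = B * norm v * indicator (cball 0 (R + norm v)) x" for x :: "real^'n"
  have "integrable lborel w"
    unfolding w_def by (intro integrable_mult_right integrable_real_indicator)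
      (use emeasure_lborel_cball_finite[of 0 "R + norm v"] in auto)
  moreover have "\<bar>diff_quot f v N x\<bar> \<le> w x" for N x
  proof (cases "norm x \<le> R + norm v")
    case True
    have "\<bar>diff_quot f v N x\<bar> \<le> real (Suc N) * (B * norm (v /\<^sub>R real (Suc N)))"
      unfolding diff_quot_def abs_mult
      by (intro mult_mono test_fun_lipschitz[OF f(1) B(2)]) (use B in auto)
    then show ?thesis using True by (simp add: w_def field_simps dist_norm del: of_nat_Suc)
  next
    case False
    have "norm (v /\<^sub>R real (Suc N)) \<le> norm v"
      by (simp add: divide_le_eq mult_le_cancel_left1 field_simps del: of_nat_Suc)
    moreover have "norm x \<le> norm (x + v /\<^sub>R real (Suc N)) + norm (v /\<^sub>R real (Suc N))"
      by (metis add_diff_cancel_right' norm_triangle_ineq4)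
    ultimately have "x \<notin> \<Omega>" "x + v /\<^sub>R real (Suc N) \<notin> \<Omega>"
      using False R[of x] R[of "x + v /\<^sub>R real (Suc N)"] norm_ge_zero[of v] by linarith+
    then show ?thesis using False by (simp add: diff_quot_def test_fun_eq_0[OF f(1)] w_def)
  qed
  ultimately show ?thesis using that by blast
qed

text \<open>Integration by parts at the level of difference quotients: translation invariance moves
  the increment from \<open>f\<close> to \<psi>, where the Lipschitz constant controls it. Hence
  \<psi> need not be differentiable, and the right-hand side involves \<open>f\<close> only through
  its L1 norm, so that the estimate survives passage to limits of test functions.\<close>

lemma test_fun_grad_weak_bound:
  fixes f \<psi> :: "real^'n \<Rightarrow> real"
  assumes f: "test_fun \<Omega> f" "bounded \<Omega>"
    and \<psi>: "L-lipschitz_on UNIV \<psi>" "\<And>x. \<bar>\<psi> x\<bar> \<le> K"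
  shows "\<bar>\<integral>x. \<psi> x * (grad f x \<bullet> v) \<partial>lborel\<bar> \<le> L * norm v * (\<integral>x. \<bar>f x\<bar> \<partial>lborel)"
proof -
  have \<psi>c: "continuous_on UNIV \<psi>" using \<psi>(1) by (rule lipschitz_on_continuous_on)
  have [measurable]: "f \<in> borel_measurable borel" "grad f \<in> borel_measurable borel"
      "\<psi> \<in> borel_measurable borel"
    using test_fun_continuous[OF f(1)] test_fun_grad_continuous[OF f(1)] \<psi>c
    by (auto intro!: borel_measurable_continuous_onI)
  have [measurable]: "diff_quot f v N \<in> borel_measurable borel" for N
    unfolding diff_quot_def by measurable
  obtain w where w: "integrable lborel w" "\<And>N x. \<bar>diff_quot f v N x\<bar> \<le> w x"
    using diff_quot_dominated[OF f] by blast
  have "(\<lambda>N. \<integral>x. \<psi> x * diff_quot f v N x \<partial>lborel) \<longlonglongrightarrow> (\<integral>x. \<psi> x * (grad f x \<bullet> v) \<partial>lborel)"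
  proof (rule integral_dominated_convergence[where w = "\<lambda>x. K * w x"])
    show "AE x in lborel. (\<lambda>N. \<psi> x * diff_quot f v N x) \<longlonglongrightarrow> \<psi> x * (grad f x \<bullet> v)"
      using f by (auto intro!: tendsto_intros diff_quot_tendsto simp: test_fun_def smooth_fun_differentiable)
    show "AE x in lborel. norm (\<psi> x * diff_quot f v N x) \<le> K * w x" for N
      using w(2) \<psi>(2) by (auto simp: abs_mult intro!: mult_mono order_trans[OF abs_ge_zero \<psi>(2)])
  qed (use w in auto)
  moreover have "\<bar>\<integral>x. \<psi> x * diff_quot f v N x \<partial>lborel\<bar> \<le> L * norm v * (\<integral>x. \<bar>f x\<bar> \<partial>lborel)" for N
  proof -
    define u where "u = v /\<^sub>R real (Suc N)"
    have int: "integrable lborel (\<lambda>x. g x * f x)"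
      if "\<And>x. \<bar>g x\<bar> \<le> C" "g \<in> borel_measurable borel" for g C
      by (rule Bochner_Integration.integrable_bound[of _ "\<lambda>x. C * f x"])
       (use that test_fun_integrable[OF f] in \<open>auto simp: abs_mult intro!: mult_mono order_trans[OF abs_ge_zero that(1)] order_trans[OF that(1)]\<close>)
    have i1: "integrable lborel (\<lambda>x. \<psi> (x - u) * f x)" and i2: "integrable lborel (\<lambda>x. \<psi> x * f x)"
      using \<psi>(2) by (auto intro!: int[of _ K])
    have i3: "integrable lborel (\<lambda>x. \<psi> x * f (x + u))"
      using lborel_integrable_translation[OF i1, of u] by simp
    have "(\<integral>x. \<psi> x * diff_quot f v N x \<partial>lborel)
        = real (Suc N) * ((\<integral>x. \<psi> x * f (x + u) \<partial>lborel) - (\<integral>x. \<psi> x * f x \<partial>lborel))"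
      by (subst Bochner_Integration.integral_diff[OF i3 i2, symmetric], subst integral_mult_right_zero[symmetric])
        (simp add: diff_quot_def u_def algebra_simps)
    also have "(\<integral>x. \<psi> x * f (x + u) \<partial>lborel) = (\<integral>x. \<psi> (x - u) * f x \<partial>lborel)"
      using lborel_integral_translation[of "\<lambda>x. \<psi> (x - u) * f x" u] by simp
    also have "\<dots> - (\<integral>x. \<psi> x * f x \<partial>lborel) = (\<integral>x. (\<psi> (x - u) - \<psi> x) * f x \<partial>lborel)"
      by (subst Bochner_Integration.integral_diff[OF i1 i2, symmetric]) (simp add: algebra_simps)
    finally have eq: "\<bar>\<integral>x. \<psi> x * diff_quot f v N x \<partial>lborel\<bar>
        = real (Suc N) * \<bar>\<integral>x. (\<psi> (x - u) - \<psi> x) * f x \<partial>lborel\<bar>"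
      by (simp add: abs_mult)
    have bd: "\<bar>\<psi> (x - u) - \<psi> x\<bar> \<le> L * norm u" for x
      using lipschitz_onD[OF \<psi>(1), of "x - u" x] by (simp add: dist_norm)
    have "\<bar>\<integral>x. (\<psi> (x - u) - \<psi> x) * f x \<partial>lborel\<bar>
        \<le> (\<integral>x. \<bar>(\<psi> (x - u) - \<psi> x) * f x\<bar> \<partial>lborel)"
      by (rule integral_abs_bound)
    also have "\<dots> \<le> (\<integral>x. L * norm u * \<bar>f x\<bar> \<partial>lborel)"
      using bd test_fun_integrable[OF f] int[of "\<lambda>x. \<psi> (x - u) - \<psi> x" "L * norm u"]
      by (intro integral_mono integrable_abs) (auto simp: abs_mult intro!: mult_right_mono)
    finally have "\<bar>\<integral>x. (\<psi> (x - u) - \<psi> x) * f x \<partial>lborel\<bar>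
        \<le> L * norm u * (\<integral>x. \<bar>f x\<bar> \<partial>lborel)" by simp
    then have "\<bar>\<integral>x. \<psi> x * diff_quot f v N x \<partial>lborel\<bar>
        \<le> real (Suc N) * (L * norm u * (\<integral>x. \<bar>f x\<bar> \<partial>lborel))"
      unfolding eq by (intro mult_left_mono) auto
    then show ?thesis by (simp add: u_def field_simps del: of_nat_Suc)
  qed
  ultimately show ?thesis by (intro tendsto_upperbound[OF tendsto_rabs]) auto
qed

text \<open>The translate by \<open>v\<close> moves the support off itself; telescoping the translation into
  \<open>N\<close> equal steps bounds the norm of \<open>f\<close> by that of the difference quotient, for every \<open>N\<close>.\<close>

lemma test_fun_directional_poincare:
  fixes f :: "real^'n \<Rightarrow> real"
  assumes f: "test_fun \<Omega> f" "bounded \<Omega>" and v: "\<And>x. x \<in> \<Omega> \<Longrightarrow> x + v \<notin> \<Omega>"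
  shows "(\<integral>x. \<bar>f x\<bar> \<partial>lborel) \<le> (\<integral>x. \<bar>grad f x \<bullet> v\<bar> \<partial>lborel)"
proof -
  have [measurable]: "f \<in> borel_measurable borel" "grad f \<in> borel_measurable borel"
    using test_fun_continuous[OF f(1)] test_fun_grad_continuous[OF f(1)]
    by (auto intro!: borel_measurable_continuous_onI)
  have [measurable]: "diff_quot f v N \<in> borel_measurable borel" for N
    unfolding diff_quot_def by measurable
  obtain w where w: "integrable lborel w" "\<And>N x. \<bar>diff_quot f v N x\<bar> \<le> w x"
    using diff_quot_dominated[OF f] by blast
  have "(\<lambda>N. \<integral>x. \<bar>diff_quot f v N x\<bar> \<partial>lborel) \<longlonglongrightarrow> (\<integral>x. \<bar>grad f x \<bullet> v\<bar> \<partial>lborel)"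
  proof (rule integral_dominated_convergence[where w = w])
    show "AE x in lborel. (\<lambda>N. \<bar>diff_quot f v N x\<bar>) \<longlonglongrightarrow> \<bar>grad f x \<bullet> v\<bar>"
      using f by (auto intro!: tendsto_intros diff_quot_tendsto simp: test_fun_def smooth_fun_differentiable)
  qed (use w in auto)
  moreover have "(\<integral>x. \<bar>f x\<bar> \<partial>lborel) \<le> (\<integral>x. \<bar>diff_quot f v N x\<bar> \<partial>lborel)" for N
  proof -
    define u where "u = v /\<^sub>R real (Suc N)"
    have fi: "integrable lborel f" by (rule test_fun_integrable[OF f])
    note ti = lborel_integrable_translation[OF fi]
    have Nu: "real (Suc N) *\<^sub>R u = v" by (simp add: u_def del: of_nat_Suc)
    have "(\<integral>x. \<bar>f x\<bar> \<partial>lborel)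
        \<le> (\<integral>x. (\<Sum>k<Suc N. \<bar>f (x + real k *\<^sub>R u + u) - f (x + real k *\<^sub>R u)\<bar>) \<partial>lborel)"
    proof (rule integral_mono)
      fix x
      have "f (x + v) - f x = (\<Sum>k<Suc N. f (x + real (Suc k) *\<^sub>R u) - f (x + real k *\<^sub>R u))"
        using sum_lessThan_telescope[of "\<lambda>k. f (x + real k *\<^sub>R u)" "Suc N"]
        by (simp only: Nu) simp
      then have "\<bar>f (x + v) - f x\<bar> \<le> (\<Sum>k<Suc N. \<bar>f (x + real (Suc k) *\<^sub>R u) - f (x + real k *\<^sub>R u)\<bar>)"
        by (simp only: sum_abs)
      moreover have "\<bar>f x\<bar> \<le> \<bar>f (x + v) - f x\<bar>"
        using v[of x] test_fun_eq_0[OF f(1)] by (cases "x \<in> \<Omega>") auto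
      moreover have "x + real (Suc k) *\<^sub>R u = x + real k *\<^sub>R u + u" for k
        by (simp add: algebra_simps)
      ultimately show "\<bar>f x\<bar> \<le> (\<Sum>k<Suc N. \<bar>f (x + real k *\<^sub>R u + u) - f (x + real k *\<^sub>R u)\<bar>)"
        by (simp only: order_trans)
    qed (use fi ti[of "_ + _"] ti in \<open>auto simp: add.assoc intro!: Bochner_Integration.integrable_sum\<close>)
    also have "\<dots> = (\<Sum>k<Suc N. \<integral>x. \<bar>f (x + real k *\<^sub>R u + u) - f (x + real k *\<^sub>R u)\<bar> \<partial>lborel)"
      by (rule Bochner_Integration.integral_sum) (use ti in \<open>auto simp: add.assoc\<close>)
    also have "\<dots> = (\<Sum>k<Suc N. \<integral>x. \<bar>f (x + u) - f x\<bar> \<partial>lborel)"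
      by (intro sum.cong refl lborel_integral_translation[of "\<lambda>x. \<bar>f (x + u) - f x\<bar>"]) measurable
    also have "\<dots> = (\<integral>x. \<bar>diff_quot f v N x\<bar> \<partial>lborel)"
      by (simp add: diff_quot_def abs_mult u_def del: of_nat_Suc)
    finally show ?thesis .
  qed
  ultimately show ?thesis by (intro tendsto_lowerbound) auto
qed

section \<open>Integrals of powers on bounded domains\<close>

lemma powr_add_le:
  fixes a b p :: real
  assumes "a \<ge> 0" "b \<ge> 0" "p > 0"
  shows "(a + b) powr p \<le> 2 powr p * (a powr p + b powr p)"
proof -
  have "(a + b) powr p \<le> (2 * max a b) powr p"
    using assms by (intro powr_mono2) auto
  also have "\<dots> = 2 powr p * max a b powr p" using assms by (simp add: powr_mult)
  also have "\<dots> \<le> 2 powr p * (a powr p + b powr p)"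
    by (intro mult_left_mono) (auto simp: max_def)
  finally show ?thesis .
qed

lemma Lp_int_eq:
  "\<Omega> \<in> sets lebesgue \<Longrightarrow> Lp_int \<Omega> p f = (\<integral>\<^sup>+x. ennreal (\<bar>f x\<bar> powr p) \<partial>lebesgue_on \<Omega>)"
  by (simp add: Lp_int_def nn_integral_restrict_space)

lemma Lp_int_cong_AE:
  assumes "\<Omega> \<in> sets lebesgue" "AE x in lebesgue_on \<Omega>. \<bar>f x\<bar> = \<bar>g x\<bar>"
  shows "Lp_int \<Omega> p f = Lp_int \<Omega> p g"
  unfolding Lp_int_eq[OF assms(1)] using assms(2) by (intro nn_integral_cong_AE) auto

text \<open>\<open>Lp_int\<close> is the p-th power of a norm and satisfies the triangle inequality
  only up to a factor. The crude factor from \<open>powr_add_le\<close> is harmless, since the bound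
  serves to transfer finiteness and convergence to 0.\<close>

lemma Lp_int_le_add:
  assumes \<Omega>: "\<Omega> \<in> sets lebesgue" and p: "p > 0" and ab: "a \<ge> 0" "b \<ge> 0"
    and [measurable]: "f \<in> borel_measurable (lebesgue_on \<Omega>)" "g \<in> borel_measurable (lebesgue_on \<Omega>)"
    and le: "\<And>x. \<bar>h x\<bar> \<le> a * \<bar>f x\<bar> + b * \<bar>g x\<bar>"
  shows "Lp_int \<Omega> p h \<le> ennreal ((2 * a) powr p) * Lp_int \<Omega> p f + ennreal ((2 * b) powr p) * Lp_int \<Omega> p g"
proof -
  have "ennreal (\<bar>h x\<bar> powr p)
      \<le> ennreal ((2 * a) powr p) * ennreal (\<bar>f x\<bar> powr p) + ennreal ((2 * b) powr p) * ennreal (\<bar>g x\<bar> powr p)"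
    for x
  proof -
    have "\<bar>h x\<bar> powr p \<le> (a * \<bar>f x\<bar> + b * \<bar>g x\<bar>) powr p"
      using p le by (intro powr_mono2) auto
    also have "\<dots> \<le> 2 powr p * ((a * \<bar>f x\<bar>) powr p + (b * \<bar>g x\<bar>) powr p)"
      using ab p by (intro powr_add_le) auto
    also have "\<dots> = (2 * a) powr p * \<bar>f x\<bar> powr p + (2 * b) powr p * \<bar>g x\<bar> powr p"
      using ab by (simp add: powr_mult algebra_simps)
    finally show ?thesis by (simp flip: ennreal_mult' ennreal_plus)
  qed
  then have "Lp_int \<Omega> p h \<le> (\<integral>\<^sup>+x. ennreal ((2 * a) powr p) * ennreal (\<bar>f x\<bar> powr p)
      + ennreal ((2 * b) powr p) * ennreal (\<bar>g x\<bar> powr p) \<partial>lebesgue_on \<Omega>)"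
    unfolding Lp_int_eq[OF \<Omega>] by (intro nn_integral_mono)
  also have "\<dots> = ennreal ((2 * a) powr p) * Lp_int \<Omega> p f + ennreal ((2 * b) powr p) * Lp_int \<Omega> p g"
    unfolding Lp_int_eq[OF \<Omega>] by (subst nn_integral_add) (auto simp: nn_integral_cmult)
  finally show ?thesis .
qed

text \<open>A pointwise splitting at the level \<open>e = Lp_norm \<Omega> p f\<close> replaces
  Hoelder's inequality. With this choice both resulting terms are multiples of \<open>e\<close>,
  which yields the factor \<open>measure lebesgue \<Omega> + 1\<close>. The level must be positive,
  so a vanishing integral is treated separately.\<close>

lemma nn_integral_abs_le_Lp_norm:
  assumes \<Omega>: "\<Omega> \<in> sets lebesgue" "bounded \<Omega>" and p: "p \<ge> 1"
    and [measurable]: "f \<in> borel_measurable (lebesgue_on \<Omega>)"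
    and fin: "Lp_int \<Omega> p f < \<infinity>"
  shows "(\<integral>\<^sup>+x. ennreal \<bar>f x\<bar> \<partial>lebesgue_on \<Omega>) \<le> ennreal ((measure lebesgue \<Omega> + 1) * Lp_norm \<Omega> p f)"
proof (cases "Lp_int \<Omega> p f = 0")
  case True
  then have "AE x in lebesgue_on \<Omega>. f x = 0"
    unfolding Lp_int_eq[OF \<Omega>(1)] by (subst (asm) nn_integral_0_iff_AE) (auto simp: not_less)
  then have "(\<integral>\<^sup>+x. ennreal \<bar>f x\<bar> \<partial>lebesgue_on \<Omega>) = 0"
    by (subst nn_integral_0_iff_AE) auto
  then show ?thesis by simp
next
  case False
  define I where "I = enn2real (Lp_int \<Omega> p f)"
  define e where "e = I powr (1 / p)"
  have I: "Lp_int \<Omega> p f = ennreal I" using fin by (simp add: I_def)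
  have "I \<noteq> 0" using False unfolding I by auto
  then have "I > 0" unfolding I_def using enn2real_nonneg order_le_less by metis
  then have e: "e > 0" by (simp add: e_def)
  \<comment> \<open>Above the level \<open>e\<close>, the exponent \<open>1 - p\<close> is
    nonpositive, so the factor \<open>\<bar>f x\<bar> powr (1 - p)\<close> is at most
    \<open>e powr (1 - p)\<close>; below it the first summand suffices.\<close>
  have "\<bar>f x\<bar> \<le> e + e powr (1 - p) * \<bar>f x\<bar> powr p" for x
  proof (cases "\<bar>f x\<bar> \<le> e")
    case False
    then have "\<bar>f x\<bar> = \<bar>f x\<bar> powr (1 - p) * \<bar>f x\<bar> powr p"
      using e by (simp flip: powr_add)
    also have "\<dots> \<le> e powr (1 - p) * \<bar>f x\<bar> powr p"
      using e p False by (intro mult_right_mono powr_mono2') auto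
    finally show ?thesis using e by linarith
  qed (use e in \<open>auto intro: add_increasing2\<close>)
  then have "ennreal \<bar>f x\<bar> \<le> ennreal e + ennreal (e powr (1 - p)) * ennreal (\<bar>f x\<bar> powr p)" for x
    using e by (simp flip: ennreal_mult' ennreal_plus)
  then have "(\<integral>\<^sup>+x. ennreal \<bar>f x\<bar> \<partial>lebesgue_on \<Omega>)
      \<le> (\<integral>\<^sup>+x. ennreal e + ennreal (e powr (1 - p)) * ennreal (\<bar>f x\<bar> powr p) \<partial>lebesgue_on \<Omega>)"
    by (intro nn_integral_mono)
  also have "\<dots> = ennreal e * emeasure lebesgue \<Omega> + ennreal (e powr (1 - p)) * ennreal I"
    by (subst nn_integral_add)
      (auto simp: nn_integral_cmult emeasure_restrict_space \<Omega> Lp_int_eq[OF \<Omega>(1), symmetric] I)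
  also have "emeasure lebesgue \<Omega> = ennreal (measure lebesgue \<Omega>)"
    using bounded_set_imp_lmeasurable[OF \<Omega>(2,1)] by (simp add: emeasure_eq_measure2)
  also have "ennreal e * ennreal (measure lebesgue \<Omega>) + ennreal (e powr (1 - p)) * ennreal I
      = ennreal (e * measure lebesgue \<Omega> + e powr (1 - p) * I)"
    using e \<open>I > 0\<close> by (simp flip: ennreal_mult' ennreal_plus)
  also have "I = e powr p" using \<open>I > 0\<close> p by (simp add: e_def powr_powr)
  also have "e powr (1 - p) * e powr p = e" using e by (simp flip: powr_add)
  also have "e * measure lebesgue \<Omega> + e = (measure lebesgue \<Omega> + 1) * Lp_norm \<Omega> p f"
    by (simp add: e_def I_def Lp_norm_def algebra_simps)
  finally show ?thesis .
qed

lemma Lp_tendsto_0_imp_L1_tendsto_0: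
  assumes \<Omega>: "\<Omega> \<in> sets lebesgue" "bounded \<Omega>" and p: "p \<ge> 1"
    and f: "\<And>k. f k \<in> borel_measurable (lebesgue_on \<Omega>)"
    and lim: "(\<lambda>k. Lp_int \<Omega> p (f k)) \<longlonglongrightarrow> 0"
  shows "(\<lambda>k. \<integral>\<^sup>+x. ennreal \<bar>f k x\<bar> \<partial>lebesgue_on \<Omega>) \<longlonglongrightarrow> 0"
proof (rule tendsto_sandwich[of "\<lambda>_. 0"])
  have "(\<lambda>k. enn2real (Lp_int \<Omega> p (f k))) \<longlonglongrightarrow> 0"
    using tendsto_enn2real[OF lim[folded ennreal_0]] by simp
  then have "(\<lambda>k. Lp_norm \<Omega> p (f k)) \<longlonglongrightarrow> 0"
    unfolding Lp_norm_def using p by (intro tendsto_zero_powrI) auto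
  then have "(\<lambda>k. ennreal ((measure lebesgue \<Omega> + 1) * Lp_norm \<Omega> p (f k)))
      \<longlonglongrightarrow> ennreal ((measure lebesgue \<Omega> + 1) * 0)"
    by (intro tendsto_intros)
  then show "(\<lambda>k. ennreal ((measure lebesgue \<Omega> + 1) * Lp_norm \<Omega> p (f k))) \<longlonglongrightarrow> 0" by simp
  have "\<forall>\<^sub>F k in sequentially. Lp_int \<Omega> p (f k) < \<infinity>"
    using lim by (rule order_tendstoD) simp
  then show "\<forall>\<^sub>F k in sequentially. (\<integral>\<^sup>+x. ennreal \<bar>f k x\<bar> \<partial>lebesgue_on \<Omega>)
      \<le> ennreal ((measure lebesgue \<Omega> + 1) * Lp_norm \<Omega> p (f k))"
    by eventually_elim (rule nn_integral_abs_le_Lp_norm[OF \<Omega> p f])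
qed auto

lemma finite_Lp_int_imp_integrable:
  assumes "\<Omega> \<in> sets lebesgue" "bounded \<Omega>" "p \<ge> 1"
    and "f \<in> borel_measurable (lebesgue_on \<Omega>)" "Lp_int \<Omega> p f < \<infinity>"
  shows "integrable (lebesgue_on \<Omega>) f"
  using assms nn_integral_abs_le_Lp_norm[OF assms]
  by (auto intro!: integrableI_bounded intro: le_less_trans)

text \<open>Test functions are studied on the whole space with \<open>lborel\<close>, where
  translation invariance is at hand, whereas members of \<open>W0\<close> are only controlled on
  \<Omega>. This identity carries the estimates over, since test functions and their gradients
  vanish off \<Omega>.\<close>

lemma integral_lborel_eq_lebesgue_on:
  fixes f :: "'a::euclidean_space \<Rightarrow> real"
  assumes "\<Omega> \<in> sets lebesgue" "f \<in> borel_measurable borel" "\<And>x. x \<notin> \<Omega> \<Longrightarrow> f x = 0"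
  shows "(\<integral>x. f x \<partial>lborel) = (\<integral>x. f x \<partial>lebesgue_on \<Omega>)"
proof -
  have "(\<integral>x. f x \<partial>lebesgue_on \<Omega>) = (\<integral>x. indicator \<Omega> x *\<^sub>R f x \<partial>lebesgue)"
    using assms(1) by (intro integral_restrict_space) simp
  also have "(\<lambda>x. indicator \<Omega> x *\<^sub>R f x) = f" using assms(3) by (fastforce simp: indicator_def)
  also have "(\<integral>x. f x \<partial>lebesgue) = (\<integral>x. f x \<partial>lborel)"
    using assms(2) by (intro integral_completion) simp
  finally show ?thesis by simp
qed

lemma integrable_lborel_imp_lebesgue_on:
  fixes f :: "'a::euclidean_space \<Rightarrow> real"
  assumes "\<Omega> \<in> sets lebesgue" "integrable lborel f"
  shows "integrable (lebesgue_on \<Omega>) f"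
proof -
  have "integrable lebesgue f" using assms by (simp add: integrable_completion)
  then show ?thesis
    using assms(1) by (simp add: integrable_restrict_space integrable_mult_indicator del: real_scaleR_def)
qed

section \<open>Weak gradients\<close>

lemma W0_grad_measurable:
  assumes "W0_grad \<Omega> p u G" "\<Omega> \<in> sets lebesgue"
  shows "u \<in> borel_measurable (lebesgue_on \<Omega>)" "G \<in> borel_measurable (lebesgue_on \<Omega>)"
  using assms by (auto simp: W0_grad_def intro: measurable_restrict_space1)

lemma test_fun_measurable:
  assumes "test_fun \<Omega> f"
  shows "f \<in> borel_measurable (lebesgue_on S)" "grad f \<in> borel_measurable (lebesgue_on S)"
  using test_fun_continuous[OF assms, of UNIV] test_fun_grad_continuous[OF assms, of UNIV]
  by (auto intro!: measurable_restrict_space1 measurable_completion borel_measurable_continuous_onI)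

lemma W0_grad_integrable:
  assumes "W0_grad \<Omega> p u G" "bounded \<Omega>" "\<Omega> \<in> sets lebesgue" "p \<ge> 1"
  shows "integrable (lebesgue_on \<Omega>) u" "integrable (lebesgue_on \<Omega>) G"
proof -
  note meas[measurable] = W0_grad_measurable[OF assms(1,3)]
  show "integrable (lebesgue_on \<Omega>) u"
    using assms by (intro finite_Lp_int_imp_integrable[of _ p]) (auto simp: W0_grad_def)
  have "integrable (lebesgue_on \<Omega>) (\<lambda>x. norm (G x))"
    using assms by (intro finite_Lp_int_imp_integrable[of _ p]) (auto simp: W0_grad_def)
  then show "integrable (lebesgue_on \<Omega>) G" by (simp add: integrable_norm_iff)
qed

text \<open>Reduction of the exponent \<open>p\<close> to 1: the estimates for test functions are
  stated with L1 norms, so this form of approximation is enough to extend them.\<close>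

lemma W0_grad_L1_approx:
  assumes W: "W0_grad \<Omega> p u G" and \<Omega>: "bounded \<Omega>" "\<Omega> \<in> sets lebesgue" and p: "p \<ge> 1"
  obtains \<phi> where "\<And>k. test_fun \<Omega> (\<phi> k)"
    "(\<lambda>k. \<integral>\<^sup>+x. ennreal \<bar>\<phi> k x - u x\<bar> \<partial>lebesgue_on \<Omega>) \<longlonglongrightarrow> 0"
    "(\<lambda>k. \<integral>\<^sup>+x. ennreal (norm (grad (\<phi> k) x - G x)) \<partial>lebesgue_on \<Omega>) \<longlonglongrightarrow> 0"
proof -
  note meas[measurable] = W0_grad_measurable[OF W \<Omega>(2)]
  obtain \<phi> where \<phi>: "\<And>k. test_fun \<Omega> (\<phi> k)"
    "(\<lambda>k. Lp_int \<Omega> p (\<lambda>x. \<phi> k x - u x)) \<longlonglongrightarrow> 0"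
    "(\<lambda>k. Lp_int \<Omega> p (\<lambda>x. norm (grad (\<phi> k) x - G x))) \<longlonglongrightarrow> 0"
    using W unfolding W0_grad_def by blast
  note [measurable] = test_fun_measurable[OF \<phi>(1)]
  have "(\<lambda>k. \<integral>\<^sup>+x. ennreal \<bar>\<phi> k x - u x\<bar> \<partial>lebesgue_on \<Omega>) \<longlonglongrightarrow> 0"
    by (rule Lp_tendsto_0_imp_L1_tendsto_0[OF \<Omega>(2,1) p _ \<phi>(2)]) measurable
  moreover have "(\<lambda>k. \<integral>\<^sup>+x. ennreal \<bar>norm (grad (\<phi> k) x - G x)\<bar> \<partial>lebesgue_on \<Omega>) \<longlonglongrightarrow> 0"
    by (rule Lp_tendsto_0_imp_L1_tendsto_0[OF \<Omega>(2,1) p _ \<phi>(3)]) measurable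
  ultimately show ?thesis using that[of \<phi>] \<phi>(1) by simp
qed

lemma tendsto_integral_of_L1_bound:
  fixes f :: "nat \<Rightarrow> 'a \<Rightarrow> real"
  assumes "\<And>k. integrable M (f k)" "integrable M g"
    and [measurable]: "\<And>k. h k \<in> borel_measurable M"
    and "C \<ge> 0" "\<And>k x. \<bar>f k x - g x\<bar> \<le> C * h k x" "\<And>k x. h k x \<ge> 0"
    and lim: "(\<lambda>k. \<integral>\<^sup>+x. ennreal (h k x) \<partial>M) \<longlonglongrightarrow> 0"
  shows "(\<lambda>k. \<integral>x. f k x \<partial>M) \<longlonglongrightarrow> (\<integral>x. g x \<partial>M)"
proof (rule tendsto_L1_int[OF assms(1,2)])
  show "(\<lambda>k. \<integral>\<^sup>+x. ennreal (norm (f k x - g x)) \<partial>M) \<longlonglongrightarrow> 0"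
  proof (rule tendsto_sandwich[of "\<lambda>_. 0"])
    have "(\<integral>\<^sup>+x. ennreal (norm (f k x - g x)) \<partial>M) \<le> (\<integral>\<^sup>+x. ennreal C * ennreal (h k x) \<partial>M)" for k
      using assms by (intro nn_integral_mono) (simp flip: ennreal_mult')
    also have "(\<integral>\<^sup>+x. ennreal C * ennreal (h k x) \<partial>M) = ennreal C * (\<integral>\<^sup>+x. ennreal (h k x) \<partial>M)" for k
      by (rule nn_integral_cmult) measurable
    finally show "\<forall>\<^sub>F k in sequentially. (\<integral>\<^sup>+x. ennreal (norm (f k x - g x)) \<partial>M)
        \<le> ennreal C * (\<integral>\<^sup>+x. ennreal (h k x) \<partial>M)" by simp
    have "(\<lambda>k. ennreal C * (\<integral>\<^sup>+x. ennreal (h k x) \<partial>M)) \<longlonglongrightarrow> ennreal C * 0"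
      by (intro tendsto_intros lim) simp
    then show "(\<lambda>k. ennreal C * (\<integral>\<^sup>+x. ennreal (h k x) \<partial>M)) \<longlonglongrightarrow> 0" by simp
  qed auto
qed

text \<open>Both sides of the estimate for test functions are continuous under L1 convergence of the
  functions and their gradients; boundedness of \<psi> takes care of the left-hand side. Applied to
  a function that vanishes almost everywhere, it says that its gradient is orthogonal to all bounded
  Lipschitz functions.\<close>

lemma W0_grad_weak_bound:
  fixes u \<psi> :: "real^'n \<Rightarrow> real"
  assumes W: "W0_grad \<Omega> p u G" and \<Omega>: "bounded \<Omega>" "\<Omega> \<in> sets lebesgue" and p: "p \<ge> 1"
    and \<psi>: "L-lipschitz_on UNIV \<psi>" "\<And>x. \<bar>\<psi> x\<bar> \<le> K"
  shows "\<bar>\<integral>x. \<psi> x * (G x \<bullet> v) \<partial>lebesgue_on \<Omega>\<bar> \<le> L * norm v * (\<integral>x. \<bar>u x\<bar> \<partial>lebesgue_on \<Omega>)"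
proof -
  let ?M = "lebesgue_on \<Omega>"
  note meas[measurable] = W0_grad_measurable[OF W \<Omega>(2)]
  obtain \<phi> where \<phi>: "\<And>k. test_fun \<Omega> (\<phi> k)"
    "(\<lambda>k. \<integral>\<^sup>+x. ennreal \<bar>\<phi> k x - u x\<bar> \<partial>?M) \<longlonglongrightarrow> 0"
    "(\<lambda>k. \<integral>\<^sup>+x. ennreal (norm (grad (\<phi> k) x - G x)) \<partial>?M) \<longlonglongrightarrow> 0"
    using W0_grad_L1_approx[OF W \<Omega> p] by blast
  note [measurable] = test_fun_measurable[OF \<phi>(1)]
  have \<psi>c: "continuous_on UNIV \<psi>" using \<psi>(1) by (rule lipschitz_on_continuous_on)
  then have \<psi>b[measurable]: "\<psi> \<in> borel_measurable borel" by (rule borel_measurable_continuous_onI)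
  then have [measurable]: "\<psi> \<in> borel_measurable ?M"
    by (auto intro!: measurable_restrict_space1 measurable_completion)
  have gb[measurable]: "\<phi> k \<in> borel_measurable borel" "grad (\<phi> k) \<in> borel_measurable borel" for k
    using test_fun_continuous[OF \<phi>(1)] test_fun_grad_continuous[OF \<phi>(1)]
    by (auto intro!: borel_measurable_continuous_onI)
  have \<phi>i: "integrable ?M (\<phi> k)" "integrable ?M (\<lambda>x. grad (\<phi> k) x \<bullet> v)" for k
    using test_fun_integrable[OF \<phi>(1) \<Omega>(1)] integrable_lborel_imp_lebesgue_on[OF \<Omega>(2)] by blast+
  have ui: "integrable ?M u" "integrable ?M (\<lambda>x. G x \<bullet> v)"
    using W0_grad_integrable[OF W \<Omega> p] by auto
  have K: "K \<ge> 0" using order_trans[OF abs_ge_zero \<psi>(2)] by simp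
  have mi: "integrable ?M (\<lambda>x. \<psi> x * g x)" if "integrable ?M g" for g
    by (rule Bochner_Integration.integrable_bound[of _ "\<lambda>x. K * g x"])
      (use that K \<psi>(2) in \<open>auto simp: abs_mult intro!: mult_right_mono\<close>)
  have "(\<lambda>k. \<integral>x. \<psi> x * (grad (\<phi> k) x \<bullet> v) \<partial>?M) \<longlonglongrightarrow> (\<integral>x. \<psi> x * (G x \<bullet> v) \<partial>?M)"
  proof (rule tendsto_integral_of_L1_bound[where C = "K * norm v", OF _ _ _ _ _ _ \<phi>(3)])
    fix k x
    have "\<bar>\<psi> x * (grad (\<phi> k) x \<bullet> v) - \<psi> x * (G x \<bullet> v)\<bar> = \<bar>\<psi> x\<bar> * \<bar>(grad (\<phi> k) x - G x) \<bullet> v\<bar>"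
      by (simp add: inner_diff_left abs_mult flip: right_diff_distrib)
    also have "\<dots> \<le> K * (norm (grad (\<phi> k) x - G x) * norm v)"
      using \<psi>(2) K by (intro mult_mono Cauchy_Schwarz_ineq2) auto
    finally show "\<bar>\<psi> x * (grad (\<phi> k) x \<bullet> v) - \<psi> x * (G x \<bullet> v)\<bar>
        \<le> K * norm v * norm (grad (\<phi> k) x - G x)" by (simp add: mult_ac)
  qed (use K in \<open>auto intro!: mi \<phi>i ui\<close>)
  moreover have "(\<lambda>k. \<integral>x. \<bar>\<phi> k x\<bar> \<partial>?M) \<longlonglongrightarrow> (\<integral>x. \<bar>u x\<bar> \<partial>?M)"
    by (rule tendsto_integral_of_L1_bound[where C = 1, OF _ _ _ _ _ _ \<phi>(2)])
      (auto intro!: integrable_abs \<phi>i ui)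
  moreover have "\<bar>\<integral>x. \<psi> x * (grad (\<phi> k) x \<bullet> v) \<partial>?M\<bar> \<le> L * norm v * (\<integral>x. \<bar>\<phi> k x\<bar> \<partial>?M)" for k
    using test_fun_grad_weak_bound[OF \<phi>(1) \<Omega>(1) \<psi>, of k v]
    by (simp add: integral_lborel_eq_lebesgue_on[OF \<Omega>(2)] test_fun_eq_0[OF \<phi>(1)] test_fun_grad_eq_0'[OF \<phi>(1)])
  ultimately show ?thesis
    by (intro tendsto_le[OF _ tendsto_mult_left tendsto_rabs]) auto
qed

lemma W0_grad_directional_poincare:
  fixes u :: "real^'n \<Rightarrow> real"
  assumes W: "W0_grad \<Omega> p u G" and \<Omega>: "bounded \<Omega>" "\<Omega> \<in> sets lebesgue" and p: "p \<ge> 1"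
    and v: "\<And>x. x \<in> \<Omega> \<Longrightarrow> x + v \<notin> \<Omega>"
  shows "(\<integral>x. \<bar>u x\<bar> \<partial>lebesgue_on \<Omega>) \<le> (\<integral>x. \<bar>G x \<bullet> v\<bar> \<partial>lebesgue_on \<Omega>)"
proof -
  let ?M = "lebesgue_on \<Omega>"
  note meas[measurable] = W0_grad_measurable[OF W \<Omega>(2)]
  obtain \<phi> where \<phi>: "\<And>k. test_fun \<Omega> (\<phi> k)"
    "(\<lambda>k. \<integral>\<^sup>+x. ennreal \<bar>\<phi> k x - u x\<bar> \<partial>?M) \<longlonglongrightarrow> 0"
    "(\<lambda>k. \<integral>\<^sup>+x. ennreal (norm (grad (\<phi> k) x - G x)) \<partial>?M) \<longlonglongrightarrow> 0"
    using W0_grad_L1_approx[OF W \<Omega> p] by blast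
  note [measurable] = test_fun_measurable[OF \<phi>(1)]
  have gb[measurable]: "\<phi> k \<in> borel_measurable borel" "grad (\<phi> k) \<in> borel_measurable borel" for k
    using test_fun_continuous[OF \<phi>(1)] test_fun_grad_continuous[OF \<phi>(1)]
    by (auto intro!: borel_measurable_continuous_onI)
  have \<phi>i: "integrable ?M (\<phi> k)" "integrable ?M (\<lambda>x. grad (\<phi> k) x \<bullet> v)" for k
    using test_fun_integrable[OF \<phi>(1) \<Omega>(1)] integrable_lborel_imp_lebesgue_on[OF \<Omega>(2)] by blast+
  have ui: "integrable ?M u" "integrable ?M (\<lambda>x. G x \<bullet> v)"
    using W0_grad_integrable[OF W \<Omega> p] by auto
  have "(\<lambda>k. \<integral>x. \<bar>grad (\<phi> k) x \<bullet> v\<bar> \<partial>?M) \<longlonglongrightarrow> (\<integral>x. \<bar>G x \<bullet> v\<bar> \<partial>?M)"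
  proof (rule tendsto_integral_of_L1_bound[where C = "norm v", OF _ _ _ _ _ _ \<phi>(3)])
    fix k x
    have "\<bar>\<bar>grad (\<phi> k) x \<bullet> v\<bar> - \<bar>G x \<bullet> v\<bar>\<bar> \<le> \<bar>(grad (\<phi> k) x - G x) \<bullet> v\<bar>"
      by (simp add: inner_diff_left)
    also have "\<dots> \<le> norm (grad (\<phi> k) x - G x) * norm v" by (rule Cauchy_Schwarz_ineq2)
    finally show "\<bar>\<bar>grad (\<phi> k) x \<bullet> v\<bar> - \<bar>G x \<bullet> v\<bar>\<bar> \<le> norm v * norm (grad (\<phi> k) x - G x)"
      by (simp add: mult_ac)
  qed (auto intro!: integrable_abs \<phi>i ui)
  moreover have "(\<lambda>k. \<integral>x. \<bar>\<phi> k x\<bar> \<partial>?M) \<longlonglongrightarrow> (\<integral>x. \<bar>u x\<bar> \<partial>?M)"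
    by (rule tendsto_integral_of_L1_bound[where C = 1, OF _ _ _ _ _ _ \<phi>(2)])
      (auto intro!: integrable_abs \<phi>i ui)
  moreover have "(\<integral>x. \<bar>\<phi> k x\<bar> \<partial>?M) \<le> (\<integral>x. \<bar>grad (\<phi> k) x \<bullet> v\<bar> \<partial>?M)" for k
    using test_fun_directional_poincare[OF \<phi>(1) \<Omega>(1) v, of k]
    by (simp add: integral_lborel_eq_lebesgue_on[OF \<Omega>(2)] test_fun_eq_0[OF \<phi>(1)] test_fun_grad_eq_0'[OF \<phi>(1)])
  ultimately show ?thesis by (intro LIMSEQ_le) auto
qed

text \<open>Indicators of closed sets are pointwise limits of bounded Lipschitz functions, so
  \<open>g\<close> has integral 0 over the part of \<Omega> in any closed set. The set where
  \<open>g\<close> is positive is, up to a null set, a countable union of closed sets; on each of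
  them \<open>g\<close> is positive with integral 0, so each is null in \<Omega>. The sign
  \<open>s\<close> covers the negative part by the same argument.\<close>

lemma AE_eq_0_if_lipschitz_integrals_eq_0:
  fixes g :: "'a::euclidean_space \<Rightarrow> real"
  assumes \<Omega>: "\<Omega> \<in> sets lebesgue" and g: "integrable (lebesgue_on \<Omega>) g"
    and ortho: "\<And>\<psi> L K. L-lipschitz_on UNIV \<psi> \<Longrightarrow> (\<And>x. \<bar>\<psi> x\<bar> \<le> K)
        \<Longrightarrow> (\<integral>x. \<psi> x * g x \<partial>lebesgue_on \<Omega>) = 0"
  shows "AE x in lebesgue_on \<Omega>. g x = 0"
proof -
  let ?M = "lebesgue_on \<Omega>"
  have [measurable]: "g \<in> borel_measurable ?M" using g by auto
  have int0: "(\<integral>x. indicator C x * g x \<partial>?M) = 0" if C: "closed C" for C :: "'a set"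
  proof (cases "C = {}")
    case False
    \<comment> \<open>Equal to 1 on \<open>C\<close>, decreasing with slope \<open>k\<close> in the
      distance, and 0 from distance \<open>1 / k\<close> on. Closedness of \<open>C\<close> makes
      the distance positive off \<open>C\<close>, so these cut-offs tend to the indicator.\<close>
    define \<psi> where "\<psi> k x = max 0 (1 - real k * infdist x C)" for k :: nat and x
    have lip: "(real k)-lipschitz_on UNIV (\<psi> k)" for k
    proof (rule lipschitz_onI)
      fix x y :: 'a
      have "\<bar>\<psi> k x - \<psi> k y\<bar> \<le> \<bar>real k * (infdist x C - infdist y C)\<bar>"
        unfolding \<psi>_def right_diff_distrib by (auto simp: max_def abs_if)
      also have "\<dots> \<le> real k * dist x y"
        unfolding abs_mult by (simp add: infdist_triangle_abs mult_left_mono)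
      finally show "dist (\<psi> k x) (\<psi> k y) \<le> real k * dist x y" by (simp add: dist_real_def)
    qed simp
    have bd: "\<bar>\<psi> k x\<bar> \<le> 1" for k x by (simp add: \<psi>_def infdist_nonneg)
    have [measurable]: "\<psi> k \<in> borel_measurable ?M" for k
      using lipschitz_on_continuous_on[OF lip]
      by (auto intro!: measurable_restrict_space1 measurable_completion borel_measurable_continuous_onI)
    have [measurable]: "C \<in> sets lebesgue" using C by simp
    have [measurable]: "indicator C \<in> borel_measurable ?M"
      by (intro measurable_restrict_space1) measurable
    have "(\<lambda>k. \<integral>x. \<psi> k x * g x \<partial>?M) \<longlonglongrightarrow> (\<integral>x. indicator C x * g x \<partial>?M)"
    proof (rule integral_dominated_convergence[where w = "\<lambda>x. \<bar>g x\<bar>"])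
      have "(\<lambda>k. \<psi> k x) \<longlonglongrightarrow> indicator C x" for x
      proof (cases "x \<in> C")
        case False
        then have d: "infdist x C > 0" using C \<open>C \<noteq> {}\<close> by (simp add: infdist_pos_not_in_closed)
        obtain k0 :: nat where k0: "1 / infdist x C < real k0" using reals_Archimedean2 by blast
        have "\<psi> k x = 0" if "k \<ge> k0" for k
        proof -
          have "1 / infdist x C \<le> real k" using k0 that by simp
          then show ?thesis using d by (simp add: \<psi>_def field_simps)
        qed
        then have "\<forall>\<^sub>F k in sequentially. \<psi> k x = indicator C x"
          using False by (auto simp: eventually_sequentially)
        then show ?thesis by (rule tendsto_eventually)
      qed (simp add: \<psi>_def)
      then show "AE x in ?M. (\<lambda>k. \<psi> k x * g x) \<longlonglongrightarrow> indicator C x * g x"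
        by (auto intro!: tendsto_intros)
      show "AE x in ?M. norm (\<psi> k x * g x) \<le> \<bar>g x\<bar>" for k
        using bd[of k] by (auto simp: abs_mult intro!: mult_left_le_one_le)
    qed (use g in auto)
    moreover have "(\<integral>x. \<psi> k x * g x \<partial>?M) = 0" for k using lip bd by (rule ortho)
    ultimately show ?thesis by (simp add: LIMSEQ_const_iff)
  qed simp
  have null: "AE x in ?M. \<not> s * g x > 0" for s :: real
  proof -
    define S where "S = {x \<in> space ?M. s * g x > 0}"
    have "S \<in> sets ?M" unfolding S_def by measurable
    then have S: "S \<in> sets lebesgue" using \<Omega> by (simp add: sets_restrict_space_iff)
    obtain C T where CT: "fsigma C" "T \<in> null_sets lebesgue" "C \<union> T = S" "disjnt C T"
      using lebesgue_set_almost_fsigma[OF S] by blast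
    obtain F :: "nat \<Rightarrow> 'a set" where F: "\<And>n. closed (F n)" "C = \<Union> (range F)"
      using CT(1) by (auto simp: fsigma.simps)
    have "AE x in ?M. x \<notin> F n" for n
    proof -
      have [measurable]: "F n \<in> sets lebesgue" using F(1)[of n] by simp
      have [measurable]: "indicator (F n) \<in> borel_measurable ?M"
        by (intro measurable_restrict_space1) measurable
      have sg: "s * g x > 0" if "x \<in> F n" for x using that F(2) CT(3) by (auto simp: S_def)
      have "integrable ?M (\<lambda>x. indicator (F n) x * g x)"
        by (rule Bochner_Integration.integrable_bound[OF g])
          (auto simp del: indicator_simps split: split_indicator)
      then have i: "integrable ?M (\<lambda>x. s * (indicator (F n) x * g x))" by simp
      have nn: "0 \<le> s * (indicator (F n) x * g x)" for x
        using sg[of x] by (cases "x \<in> F n") auto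
      have "(\<integral>x. s * (indicator (F n) x * g x) \<partial>?M) = 0" by (simp add: int0[OF F(1)])
      then have "AE x in ?M. s * (indicator (F n) x * g x) = 0"
        using integral_nonneg_eq_0_iff_AE[OF i] nn by simp
      then show ?thesis
      proof eventually_elim
        case (elim x)
        then show ?case using sg[of x] by (cases "x \<in> F n") auto
      qed
    qed
    then have "AE x in ?M. \<forall>n. x \<notin> F n" by (simp add: AE_all_countable)
    moreover have "AE x in ?M. x \<notin> T"
      using AE_not_in[OF CT(2)] by (auto simp: AE_restrict_space_iff \<Omega> elim: eventually_mono)
    moreover have "AE x in ?M. x \<in> space ?M" by (rule AE_space)
    ultimately show ?thesis
    proof eventually_elim
      case (elim x)
      then have "x \<notin> S" using CT(3) F(2) by auto
      then show ?case using elim by (simp add: S_def)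
    qed
  qed
  show ?thesis using null[of 1] null[of "-1"] by eventually_elim auto
qed

section \<open>Linearity and uniqueness of weak gradients, and continuity in the
  coefficients\<close>

lemma Lp_int_zero [simp]: "Lp_int \<Omega> p (\<lambda>x. 0) = 0"
  by (simp add: Lp_int_def)

lemma Lp_int_abs [simp]: "Lp_int \<Omega> p (\<lambda>x. \<bar>f x\<bar>) = Lp_int \<Omega> p f"
  by (simp add: Lp_int_def)

lemma Lp_int_add_finite:
  assumes "\<Omega> \<in> sets lebesgue" "p > 0" "a \<ge> 0" "b \<ge> 0"
    and "f \<in> borel_measurable (lebesgue_on \<Omega>)" "g \<in> borel_measurable (lebesgue_on \<Omega>)"
    and "\<And>x. \<bar>h x\<bar> \<le> a * \<bar>f x\<bar> + b * \<bar>g x\<bar>"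
    and "Lp_int \<Omega> p f < \<infinity>" "Lp_int \<Omega> p g < \<infinity>"
  shows "Lp_int \<Omega> p h < \<infinity>"
  using assms(8,9) by (intro le_less_trans[OF Lp_int_le_add[OF assms(1-7)]]) (simp add: ennreal_mult_less_top)

lemma W0_grad_zero: "W0_grad \<Omega> p (\<lambda>x::real^'n. 0) (\<lambda>x. 0)"
proof -
  have "grad (\<lambda>x::real^'n. 0) x = 0" for x by (rule grad_eqI) simp
  then show ?thesis by (auto simp: W0_grad_def intro!: exI[of _ "\<lambda>k x. 0"] test_fun_zero)
qed

lemma W0_grad_lincomb:
  fixes u v :: "real^'n \<Rightarrow> real"
  assumes u: "W0_grad \<Omega> p u G" and v: "W0_grad \<Omega> p v H" and \<Omega>: "\<Omega> \<in> sets lebesgue" and p: "p > 0"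
  shows "W0_grad \<Omega> p (\<lambda>x. a * u x + b * v x) (\<lambda>x. a *\<^sub>R G x + b *\<^sub>R H x)"
proof -
  note [measurable] = W0_grad_measurable[OF u \<Omega>] W0_grad_measurable[OF v \<Omega>]
  obtain f where f: "\<And>k. test_fun \<Omega> (f k)" "(\<lambda>k. Lp_int \<Omega> p (\<lambda>x. f k x - u x)) \<longlonglongrightarrow> 0"
      "(\<lambda>k. Lp_int \<Omega> p (\<lambda>x. norm (grad (f k) x - G x))) \<longlonglongrightarrow> 0"
    using u unfolding W0_grad_def by blast
  obtain g where g: "\<And>k. test_fun \<Omega> (g k)" "(\<lambda>k. Lp_int \<Omega> p (\<lambda>x. g k x - v x)) \<longlonglongrightarrow> 0"
      "(\<lambda>k. Lp_int \<Omega> p (\<lambda>x. norm (grad (g k) x - H x))) \<longlonglongrightarrow> 0"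
    using v unfolding W0_grad_def by blast
  note [measurable] = test_fun_measurable[OF f(1)] test_fun_measurable[OF g(1)]
  define \<phi> where "\<phi> k x = a * f k x + b * g k x" for k x
  have \<phi>: "test_fun \<Omega> (\<phi> k)" for k
    unfolding \<phi>_def by (rule test_fun_lincomb[OF f(1) g(1)])
  have grad\<phi>: "grad (\<phi> k) x = a *\<^sub>R grad (f k) x + b *\<^sub>R grad (g k) x" for k x
    unfolding \<phi>_def using f(1) g(1)
    by (intro grad_lincomb) (auto simp: test_fun_def smooth_fun_differentiable)
  have lim: "(\<lambda>k. Lp_int \<Omega> p (h k)) \<longlonglongrightarrow> 0"
    if le: "\<And>k x. \<bar>h k x\<bar> \<le> \<bar>a\<bar> * \<bar>q k x\<bar> + \<bar>b\<bar> * \<bar>r k x\<bar>"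
      and q: "\<And>k. q k \<in> borel_measurable (lebesgue_on \<Omega>)" "(\<lambda>k. Lp_int \<Omega> p (q k)) \<longlonglongrightarrow> 0"
      and r: "\<And>k. r k \<in> borel_measurable (lebesgue_on \<Omega>)" "(\<lambda>k. Lp_int \<Omega> p (r k)) \<longlonglongrightarrow> 0"
    for h q r :: "nat \<Rightarrow> real^'n \<Rightarrow> real"
  proof (rule tendsto_sandwich[of "\<lambda>_. 0"])
    show "\<forall>\<^sub>F k in sequentially. Lp_int \<Omega> p (h k)
        \<le> ennreal ((2 * \<bar>a\<bar>) powr p) * Lp_int \<Omega> p (q k) + ennreal ((2 * \<bar>b\<bar>) powr p) * Lp_int \<Omega> p (r k)"
      using q(1) r(1) le by (intro always_eventually allI Lp_int_le_add \<Omega> p) auto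
    have "(\<lambda>k. ennreal ((2 * \<bar>a\<bar>) powr p) * Lp_int \<Omega> p (q k) + ennreal ((2 * \<bar>b\<bar>) powr p) * Lp_int \<Omega> p (r k))
        \<longlonglongrightarrow> ennreal ((2 * \<bar>a\<bar>) powr p) * 0 + ennreal ((2 * \<bar>b\<bar>) powr p) * 0"
      by (intro tendsto_intros q r) auto
    then show "(\<lambda>k. ennreal ((2 * \<bar>a\<bar>) powr p) * Lp_int \<Omega> p (q k)
        + ennreal ((2 * \<bar>b\<bar>) powr p) * Lp_int \<Omega> p (r k)) \<longlonglongrightarrow> 0" by simp
  qed auto
  have tri: "norm (a *\<^sub>R y + b *\<^sub>R z) \<le> \<bar>a\<bar> * norm y + \<bar>b\<bar> * norm z" for y z :: "real^'n"
    by (metis norm_scaleR norm_triangle_ineq)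
  have tri1: "\<bar>a * y + b * z\<bar> \<le> \<bar>a\<bar> * \<bar>y\<bar> + \<bar>b\<bar> * \<bar>z\<bar>" for y z :: real
    by (metis abs_mult abs_triangle_ineq)
  have "(\<lambda>k. Lp_int \<Omega> p (\<lambda>x. \<phi> k x - (a * u x + b * v x))) \<longlonglongrightarrow> 0"
  proof (rule lim[OF _ _ f(2) _ g(2)])
    show "\<bar>\<phi> k x - (a * u x + b * v x)\<bar> \<le> \<bar>a\<bar> * \<bar>f k x - u x\<bar> + \<bar>b\<bar> * \<bar>g k x - v x\<bar>" for k x
      using tri1[of "f k x - u x" "g k x - v x"] by (simp add: \<phi>_def algebra_simps)
  qed measurable
  moreover have "(\<lambda>k. Lp_int \<Omega> p (\<lambda>x. norm (grad (\<phi> k) x - (a *\<^sub>R G x + b *\<^sub>R H x)))) \<longlonglongrightarrow> 0"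
  proof (rule lim[OF _ _ f(3) _ g(3)])
    show "\<bar>norm (grad (\<phi> k) x - (a *\<^sub>R G x + b *\<^sub>R H x))\<bar>
        \<le> \<bar>a\<bar> * \<bar>norm (grad (f k) x - G x)\<bar> + \<bar>b\<bar> * \<bar>norm (grad (g k) x - H x)\<bar>" for k x
      using tri[of "grad (f k) x - G x" "grad (g k) x - H x"] by (simp add: grad\<phi> algebra_simps)
  qed measurable
  moreover have "Lp_int \<Omega> p (\<lambda>x. a * u x + b * v x) < \<infinity>"
    by (rule Lp_int_add_finite[OF \<Omega> p, of "\<bar>a\<bar>" "\<bar>b\<bar>" u v]) (use u v tri1 in \<open>auto simp: W0_grad_def\<close>)
  moreover have "Lp_int \<Omega> p (\<lambda>x. norm (a *\<^sub>R G x + b *\<^sub>R H x)) < \<infinity>"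
    by (rule Lp_int_add_finite[OF \<Omega> p, of "\<bar>a\<bar>" "\<bar>b\<bar>" "\<lambda>x. norm (G x)" "\<lambda>x. norm (H x)"])
      (use u v tri in \<open>auto simp: W0_grad_def\<close>)
  moreover have "(\<lambda>x. a * u x + b * v x) \<in> borel_measurable lebesgue"
      "(\<lambda>x. a *\<^sub>R G x + b *\<^sub>R H x) \<in> borel_measurable lebesgue"
    using u v by (auto simp: W0_grad_def)
  ultimately show ?thesis using \<phi> unfolding W0_grad_def by blast
qed

lemma W0_grad_sum:
  fixes m :: nat
  assumes "\<And>j. j < m \<Longrightarrow> W0_grad \<Omega> p (w j) (G j)" "\<Omega> \<in> sets lebesgue" "p > 0"
  shows "W0_grad \<Omega> p (\<lambda>x. \<Sum>j<m. c j * w j x) (\<lambda>x. \<Sum>j<m. c j *\<^sub>R G j x)"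
  using assms(1)
proof (induction m)
  case 0
  then show ?case by (simp add: W0_grad_zero)
next
  case (Suc m)
  then show ?case
    using W0_grad_lincomb[OF _ _ assms(2,3), of "\<lambda>x. \<Sum>j<m. c j * w j x"
        "\<lambda>x. \<Sum>j<m. c j *\<^sub>R G j x" "w m" "G m" 1 "c m"] by simp
qed

text \<open>The weak bound has the L1 norm of \<open>u\<close> as a factor, hence each component of
  \<open>G\<close> integrates to 0 against every bounded Lipschitz function. Combined with
  linearity, this is uniqueness of the weak gradient, without which nothing could be computed about
  the choice made in \<open>wgrad\<close>.\<close>

lemma W0_grad_AE_eq_0:
  fixes u :: "real^'n \<Rightarrow> real"
  assumes W: "W0_grad \<Omega> p u G" and \<Omega>: "bounded \<Omega>" "\<Omega> \<in> sets lebesgue" and p: "p \<ge> 1"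
    and 0: "AE x in lebesgue_on \<Omega>. u x = 0"
  shows "AE x in lebesgue_on \<Omega>. G x = 0"
proof -
  have i: "integrable (lebesgue_on \<Omega>) (\<lambda>x. G x \<bullet> v)" for v
    using W0_grad_integrable[OF W \<Omega> p] by auto
  have u0: "(\<integral>x. \<bar>u x\<bar> \<partial>lebesgue_on \<Omega>) = 0"
    by (rule integral_eq_zero_AE) (use 0 in auto)
  have "AE x in lebesgue_on \<Omega>. G x \<bullet> v = 0" for v
  proof (rule AE_eq_0_if_lipschitz_integrals_eq_0[OF \<Omega>(2) i])
    fix \<psi> :: "real^'n \<Rightarrow> real" and L K
    assume "L-lipschitz_on UNIV \<psi>" "\<And>x. \<bar>\<psi> x\<bar> \<le> K"
    from W0_grad_weak_bound[OF W \<Omega> p this, of v] u0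
    show "(\<integral>x. \<psi> x * (G x \<bullet> v) \<partial>lebesgue_on \<Omega>) = 0" by simp
  qed
  then have "AE x in lebesgue_on \<Omega>. \<forall>v\<in>Basis. G x \<bullet> v = 0" by (simp add: AE_finite_all)
  then show ?thesis by eventually_elim (simp add: euclidean_all_zero_iff)
qed

lemma W0_grad_unique:
  assumes u: "W0_grad \<Omega> p u G" and v: "W0_grad \<Omega> p v H"
    and \<Omega>: "bounded \<Omega>" "\<Omega> \<in> sets lebesgue" and p: "p \<ge> 1"
    and eq: "AE x in lebesgue_on \<Omega>. u x = v x"
  shows "AE x in lebesgue_on \<Omega>. G x = H x"
proof -
  have "AE x in lebesgue_on \<Omega>. 1 *\<^sub>R G x + (- 1) *\<^sub>R H x = 0"
    using W0_grad_lincomb[OF u v \<Omega>(2), of 1 "-1"] p eq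
    by (intro W0_grad_AE_eq_0[of \<Omega> p "\<lambda>x. 1 * u x + (-1) * v x"] \<Omega>) auto
  then show ?thesis by simp
qed

lemma W0_grad_directional_AE_eq_0:
  assumes W: "W0_grad \<Omega> p u G" and \<Omega>: "bounded \<Omega>" "\<Omega> \<in> sets lebesgue" and p: "p \<ge> 1"
    and \<xi>: "\<xi> \<noteq> 0" "AE x in lebesgue_on \<Omega>. G x \<bullet> \<xi> = 0"
  shows "AE x in lebesgue_on \<Omega>. u x = 0"
proof -
  obtain R where R: "R > 0" "\<And>x. x \<in> \<Omega> \<Longrightarrow> norm x \<le> R" using \<Omega>(1) by (auto simp: bounded_pos)
  \<comment> \<open>Two points of \<Omega> are at distance at most \<open>2 * R\<close>, so a shift
    of length \<open>3 * R\<close> along \<xi> moves \<Omega> off itself, as the directional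
    Poincare inequality demands.\<close>
  define v where "v = (3 * R / norm \<xi>) *\<^sub>R \<xi>"
  have nv: "norm v = 3 * R" using R \<xi> by (simp add: v_def)
  have v: "x + v \<notin> \<Omega>" if "x \<in> \<Omega>" for x
  proof
    assume "x + v \<in> \<Omega>"
    then have "norm v \<le> R + R"
      using R(2)[of x] R(2)[of "x + v"] that norm_triangle_ineq4[of "x + v" x] by simp
    then show False using nv R(1) by simp
  qed
  have "(\<integral>x. \<bar>G x \<bullet> v\<bar> \<partial>lebesgue_on \<Omega>) = 0"
    by (rule integral_eq_zero_AE) (use \<xi> in \<open>auto simp: v_def\<close>)
  then have "(\<integral>x. \<bar>u x\<bar> \<partial>lebesgue_on \<Omega>) = 0"
    using W0_grad_directional_poincare[OF W \<Omega> p v] by (simp add: antisym)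
  then show ?thesis
    using W0_grad_integrable(1)[OF W \<Omega> p]
    by (subst (asm) integral_nonneg_eq_0_iff_AE) auto
qed

lemma W0_grad_wgrad: "W0_grad \<Omega> p u G \<Longrightarrow> W0_grad \<Omega> p u (wgrad \<Omega> p u)"
  unfolding wgrad_def by (metis someI)

lemma Lp_int_sum_finite:
  fixes f :: "'j \<Rightarrow> real^'n \<Rightarrow> real"
  assumes "finite J" and \<Omega>: "\<Omega> \<in> sets lebesgue" and p: "p > 0"
    and "\<And>j. j \<in> J \<Longrightarrow> f j \<in> borel_measurable (lebesgue_on \<Omega>)"
    and "\<And>j. j \<in> J \<Longrightarrow> Lp_int \<Omega> p (f j) < \<infinity>"
  shows "Lp_int \<Omega> p (\<lambda>x. \<Sum>j\<in>J. f j x) < \<infinity>"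
  using assms(1,4,5)
proof (induction J)
  case (insert i J)
  show ?case
    by (rule Lp_int_add_finite[OF \<Omega> p, of 1 1 "f i" "\<lambda>x. \<Sum>j\<in>J. f j x"]) (use insert in auto)
qed simp

text \<open>Convergent coefficients are bounded by some \<open>C\<close>, so \<open>C\<close> times
  the sum of the norms of the \<open>f j\<close> dominates all combinations. The value type is left
  open because the lemma is applied to functions, to their gradients and to single components of the
  gradients.\<close>

lemma Lp_int_lincomb_tendsto:
  fixes f :: "'j \<Rightarrow> real^'n \<Rightarrow> 'b::{real_normed_vector, second_countable_topology}"
  assumes J: "finite J" and \<Omega>: "\<Omega> \<in> sets lebesgue" and p: "p > 0"
    and f: "\<And>j. j \<in> J \<Longrightarrow> f j \<in> borel_measurable (lebesgue_on \<Omega>)"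
    and fin: "\<And>j. j \<in> J \<Longrightarrow> Lp_int \<Omega> p (\<lambda>x. norm (f j x)) < \<infinity>"
    and c: "\<And>j. j \<in> J \<Longrightarrow> (\<lambda>k. c k j) \<longlonglongrightarrow> d j"
  shows "Lp_int \<Omega> p (\<lambda>x. norm (\<Sum>j\<in>J. d j *\<^sub>R f j x)) < \<infinity>"
    and "(\<lambda>k. Lp_int \<Omega> p (\<lambda>x. norm (\<Sum>j\<in>J. c k j *\<^sub>R f j x)))
      \<longlonglongrightarrow> Lp_int \<Omega> p (\<lambda>x. norm (\<Sum>j\<in>J. d j *\<^sub>R f j x))"
proof -
  note f[measurable]
  have "\<exists>K. \<forall>k. \<bar>c k j\<bar> \<le> K" if "j \<in> J" for j
    using convergent_imp_Bseq[OF convergentI[OF c[OF that]]] by (auto simp: Bseq_def)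
  then obtain K where K: "\<And>j k. j \<in> J \<Longrightarrow> \<bar>c k j\<bar> \<le> K j" by metis
  define C where "C = (\<Sum>j\<in>J. \<bar>K j\<bar>)"
  have "\<bar>K j\<bar> \<le> C" if "j \<in> J" for j
    unfolding C_def using that J by (intro member_le_sum) auto
  then have C: "\<bar>c k j\<bar> \<le> C" if "j \<in> J" for j k
    using K[OF that] that by (metis abs_ge_self order_trans)
  have C0: "C \<ge> 0" by (simp add: C_def sum_nonneg)
  have bound: "norm (\<Sum>j\<in>J. c k j *\<^sub>R f j x) \<le> C * (\<Sum>j\<in>J. norm (f j x))" for k x
    unfolding sum_distrib_left using C by (intro sum_norm_le) (auto intro!: mult_right_mono)
  have lim: "(\<lambda>k. norm (\<Sum>j\<in>J. c k j *\<^sub>R f j x)) \<longlonglongrightarrow> norm (\<Sum>j\<in>J. d j *\<^sub>R f j x)" for x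
    using c by (intro tendsto_intros) auto
  have bound': "norm (\<Sum>j\<in>J. d j *\<^sub>R f j x) \<le> C * (\<Sum>j\<in>J. norm (f j x))" for x
    using LIMSEQ_le_const2[OF lim] bound by blast
  have sfin: "Lp_int \<Omega> p (\<lambda>x. \<Sum>j\<in>J. norm (f j x)) < \<infinity>"
    by (rule Lp_int_sum_finite[OF J \<Omega> p]) (use fin in auto)
  have wfin: "Lp_int \<Omega> p (\<lambda>x. C * (\<Sum>j\<in>J. norm (f j x))) < \<infinity>"
    by (rule Lp_int_add_finite[OF \<Omega> p, of C 0 "\<lambda>x. \<Sum>j\<in>J. norm (f j x)" "\<lambda>x. 0"])
      (use C0 sfin in \<open>auto simp: abs_mult\<close>)
  show "Lp_int \<Omega> p (\<lambda>x. norm (\<Sum>j\<in>J. d j *\<^sub>R f j x)) < \<infinity>"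
    by (rule Lp_int_add_finite[OF \<Omega> p, of C 0 "\<lambda>x. \<Sum>j\<in>J. norm (f j x)" "\<lambda>x. 0"])
      (use C0 sfin bound' in \<open>auto simp: abs_mult sum_nonneg\<close>)
  show "(\<lambda>k. Lp_int \<Omega> p (\<lambda>x. norm (\<Sum>j\<in>J. c k j *\<^sub>R f j x)))
      \<longlonglongrightarrow> Lp_int \<Omega> p (\<lambda>x. norm (\<Sum>j\<in>J. d j *\<^sub>R f j x))"
    unfolding Lp_int_eq[OF \<Omega>]
  proof (rule nn_integral_dominated_convergence[where w = "\<lambda>x. ennreal (\<bar>C * (\<Sum>j\<in>J. norm (f j x))\<bar> powr p)"])
    show "(\<integral>\<^sup>+x. ennreal (\<bar>C * (\<Sum>j\<in>J. norm (f j x))\<bar> powr p) \<partial>lebesgue_on \<Omega>) < \<infinity>"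
      using wfin unfolding Lp_int_eq[OF \<Omega>] .
    show "AE x in lebesgue_on \<Omega>. ennreal (\<bar>norm (\<Sum>j\<in>J. c k j *\<^sub>R f j x)\<bar> powr p)
        \<le> ennreal (\<bar>C * (\<Sum>j\<in>J. norm (f j x))\<bar> powr p)" for k
      using p bound by (intro AE_I2 ennreal_leI powr_mono2) (auto intro: order_trans[OF bound])
    show "AE x in lebesgue_on \<Omega>. (\<lambda>k. ennreal (\<bar>norm (\<Sum>j\<in>J. c k j *\<^sub>R f j x)\<bar> powr p))
        \<longlonglongrightarrow> ennreal (\<bar>norm (\<Sum>j\<in>J. d j *\<^sub>R f j x)\<bar> powr p)"
      using p lim by (intro AE_I2 tendsto_ennrealI tendsto_powr' tendsto_rabs tendsto_const) auto
  qed measurable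
qed

lemma Lp_int_scale:
  assumes "\<Omega> \<in> sets lebesgue" "f \<in> borel_measurable (lebesgue_on \<Omega>)"
  shows "Lp_int \<Omega> p (\<lambda>x. t * f x) = ennreal (\<bar>t\<bar> powr p) * Lp_int \<Omega> p f"
  unfolding Lp_int_eq[OF assms(1)] using assms(2)
  by (subst nn_integral_cmult[symmetric]) (auto simp: abs_mult powr_mult ennreal_mult')

section \<open>Zeros of vector fields on star bodies\<close>

definition sphere_m :: "nat \<Rightarrow> (nat \<Rightarrow> real) set" where
  "sphere_m m = {x \<in> Rm m. inner_m m x x = 1}"

text \<open>\<open>nsphere n\<close> uses the coordinates from 0 to \<open>n\<close>, so the unit
  sphere of \<open>Rm m\<close> has index \<open>m - 1\<close>. For \<open>m = 1\<close> it is the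
  two-point sphere, which is not contractible either.\<close>

lemma top_of_set_sphere_m:
  assumes "m \<ge> 1" shows "top_of_set (sphere_m m) = nsphere (m - 1)"
proof -
  have "{..m - 1} = {..<m}" "\<And>i. i > m - 1 \<longleftrightarrow> i \<ge> m" using assms by auto
  then have "{x. (\<Sum>i\<le>m - 1. (x i)\<^sup>2) = 1 \<and> (\<forall>i>m - 1. x i = 0)} = sphere_m m"
    by (auto simp: sphere_m_def Rm_def inner_m_def power2_eq_square)
  then show ?thesis by (simp add: nsphere euclidean_product_topology)
qed

lemma continuous_on_inner_m [continuous_intros]:
  assumes "continuous_on S f" "continuous_on S g"
  shows "continuous_on S (\<lambda>x. inner_m m (f x) (g x))"
  unfolding inner_m_def
  by (intro continuous_on_sum continuous_on_mult
      continuous_on_product_then_coordinatewise[OF assms(1)]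
      continuous_on_product_then_coordinatewise[OF assms(2)])

lemma inner_m_self_nonneg: "inner_m m x x \<ge> 0"
  by (simp add: inner_m_def sum_nonneg)

lemma inner_m_self_eq_0:
  assumes "x \<in> Rm m" shows "inner_m m x x = 0 \<longleftrightarrow> x = (\<lambda>j. 0)"
  using assms by (auto simp: inner_m_def sum_nonneg_eq_0_iff Rm_def fun_eq_iff not_less[symmetric])

lemma Rm_scale: "x \<in> Rm m \<Longrightarrow> (\<lambda>j. t * x j) \<in> Rm m"
  by (simp add: Rm_def)

lemma inner_m_scale: "inner_m m (\<lambda>j. s * x j) (\<lambda>j. t * y j) = s * t * inner_m m x y"
  by (simp add: inner_m_def sum_distrib_left mult_ac)

text \<open>The ambient type of sequences carries the product topology, where compactness comes from
  Tychonoff's theorem: the sphere is a closed subset of the product of the intervals from -1 to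
  1.\<close>

lemma compact_sphere_m: "compact (sphere_m m)"
proof -
  have "compact (PiE UNIV (\<lambda>i::nat. {-1..1::real}))"
    using compactin_PiE[of "\<lambda>i. euclidean" UNIV "\<lambda>i::nat. {-1..1::real}"]
    by (simp add: euclidean_product_topology)
  moreover have "closed (sphere_m m)"
  proof -
    have "sphere_m m = (\<Inter>j\<in>{m..}. {x. x j = 0}) \<inter> {x. inner_m m x x = 1}"
      by (auto simp: sphere_m_def Rm_def)
    then show ?thesis
      by (auto intro!: closed_INT closed_Int closed_Collect_eq continuous_on_inner_m
          continuous_on_id continuous_on_const)
  qed
  moreover have "sphere_m m \<subseteq> PiE UNIV (\<lambda>i. {-1..1})"
  proof
    fix x assume x: "x \<in> sphere_m m"
    have "\<bar>x i\<bar> \<le> 1" for i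
    proof (cases "i < m")
      case True
      have "x i * x i \<le> inner_m m x x"
        unfolding inner_m_def by (rule member_le_sum) (use True in auto)
      then have "(x i)\<^sup>2 \<le> 1" using x by (simp add: sphere_m_def power2_eq_square)
      then show ?thesis by (simp add: abs_square_le_1)
    qed (use x in \<open>auto simp: sphere_m_def Rm_def\<close>)
    then show "x \<in> PiE UNIV (\<lambda>i. {-1..1})" by (auto simp: abs_le_iff minus_le_iff)
  qed
  ultimately show ?thesis by (metis Int_absorb1 compact_Int_closed)
qed

definition normalize_m :: "nat \<Rightarrow> (nat \<Rightarrow> real) \<Rightarrow> nat \<Rightarrow> real" where
  "normalize_m m x = (\<lambda>j. x j / sqrt (inner_m m x x))"

lemma normalize_m_sphere:
  assumes "x \<in> Rm m" "x \<noteq> (\<lambda>j. 0)"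
  shows "normalize_m m x \<in> sphere_m m"
proof -
  have pos: "inner_m m x x > 0"
    using assms inner_m_self_eq_0 inner_m_self_nonneg[of m x] by (metis order_le_less)
  have "inner_m m (\<lambda>j. x j / s) (\<lambda>j. x j / s) = inner_m m x x / (s * s)" for s
    by (simp add: inner_m_def sum_divide_distrib)
  then show ?thesis using assms(1) pos by (simp add: sphere_m_def Rm_def normalize_m_def)
qed

lemma normalize_m_of_sphere: "x \<in> sphere_m m \<Longrightarrow> normalize_m m x = x"
  by (simp add: normalize_m_def sphere_m_def)

lemma continuous_on_normalize_m:
  assumes "continuous_on S f" "\<And>x. x \<in> S \<Longrightarrow> f x \<in> Rm m" "\<And>x. x \<in> S \<Longrightarrow> f x \<noteq> (\<lambda>j. 0)"
  shows "continuous_on S (\<lambda>x. normalize_m m (f x))"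
  unfolding normalize_m_def
  using assms(2,3) inner_m_self_eq_0
  by (intro continuous_on_coordinatewise_then_product continuous_on_divide continuous_on_real_sqrt
      continuous_on_inner_m continuous_on_product_then_coordinatewise[OF assms(1)] assms(1)) auto

text \<open>Radial projection retracts \<open>Rm m\<close> minus the origin onto the sphere, so for
  a homotopy given by a formula in \<open>Rm m\<close> it only remains to check that it avoids the
  origin.\<close>

lemma homotopic_sphere_m_normalize:
  fixes h :: "real \<times> (nat \<Rightarrow> real) \<Rightarrow> nat \<Rightarrow> real"
  assumes cont: "continuous_on ({0..1} \<times> sphere_m m) h"
    and h: "\<And>t x. t \<in> {0..1} \<Longrightarrow> x \<in> sphere_m m \<Longrightarrow> h (t, x) \<in> Rm m \<and> h (t, x) \<noteq> (\<lambda>j. 0)"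
  shows "homotopic_with_canon (\<lambda>_. True) (sphere_m m) (sphere_m m)
    (\<lambda>x. normalize_m m (h (0, x))) (\<lambda>x. normalize_m m (h (1, x)))"
  unfolding homotopic_with_def
proof (intro exI[of _ "\<lambda>y. normalize_m m (h y)"] conjI)
  have "continuous_on ({0..1} \<times> sphere_m m) (\<lambda>y. normalize_m m (h y))"
    by (intro continuous_on_normalize_m cont) (use h in auto)
  moreover have "(\<lambda>y. normalize_m m (h y)) \<in> ({0..1} \<times> sphere_m m) \<rightarrow> sphere_m m"
    using h normalize_m_sphere by auto
  ultimately show "continuous_map (prod_topology (top_of_set {0..1}) (top_of_set (sphere_m m)))
      (top_of_set (sphere_m m)) (\<lambda>y. normalize_m m (h y))"
    by (simp add: prod_topology_subtopology_eu)
qed auto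

text \<open>Were there no zero on the star body, normalising \<open>F\<close> would contract the unit sphere:
  the boundary condition makes the identity homotopic to the normalised \<open>F\<close> on the boundary, and
  shrinking the star body radially makes the latter homotopic to a constant.\<close>

theorem exists_zero_on_star_body:
  assumes m: "m \<ge> 1"
    and F: "continuous_on (Rm m) F" "\<And>x. x \<in> Rm m \<Longrightarrow> F x \<in> Rm m"
    and r: "continuous_on (sphere_m m) r"
    and bd: "\<And>x. x \<in> sphere_m m \<Longrightarrow> inner_m m (F (\<lambda>j. r x * x j)) x \<ge> 0"
  shows "\<exists>x\<in>sphere_m m. \<exists>t\<in>{0..1}. F (\<lambda>j. t * r x * x j) = (\<lambda>j. 0)"
proof (rule ccontr)
  assume *: "\<not> ?thesis"
  let ?S = "sphere_m m" and ?hom = "homotopic_with_canon (\<lambda>_. True) (sphere_m m) (sphere_m m)"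
  have S: "?S \<subseteq> Rm m" by (auto simp: sphere_m_def)
  have nz: "F (\<lambda>j. t * r x * x j) \<noteq> (\<lambda>j. 0)" if "x \<in> ?S" "t \<in> {0..1}" for x t
    using * that by blast
  have Rx: "(\<lambda>j. s * x j) \<in> Rm m" if "x \<in> ?S" for x s using that S Rm_scale by blast
  have csnd: "continuous_on ({0..1::real} \<times> ?S) (\<lambda>y. snd y j)" for j
    by (rule continuous_on_product_then_coordinatewise) (intro continuous_on_snd continuous_on_id)
  have cF: "continuous_on ({0..1::real} \<times> ?S) (\<lambda>y. F (\<lambda>j. g (fst y) * r (snd y) * snd y j))"
    if "continuous_on {0..1::real} g" for g
  proof (rule continuous_on_compose2[OF F(1)])
    have "continuous_on ({0..1::real} \<times> ?S) (\<lambda>y. g (fst y))" "continuous_on ({0..1::real} \<times> ?S) (\<lambda>y. r (snd y))"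
      by (auto intro!: continuous_on_compose2[OF that] continuous_on_compose2[OF r]
          continuous_on_fst continuous_on_snd continuous_on_id)
    then show "continuous_on ({0..1::real} \<times> ?S) (\<lambda>y j. g (fst y) * r (snd y) * snd y j)"
      by (intro continuous_on_coordinatewise_then_product continuous_on_mult csnd)
  qed (use Rx in auto)
  have c1: "continuous_on ({0..1::real} \<times> ?S) (\<lambda>y. F (\<lambda>j. r (snd y) * snd y j))"
    using cF[of "\<lambda>_. 1"] by simp
  define h1 where "h1 y = (\<lambda>j. (1 - fst y) * snd y j + fst y * F (\<lambda>j. r (snd y) * snd y j) j)"
    for y :: "real \<times> (nat \<Rightarrow> real)"
  have H1: "?hom (\<lambda>x. normalize_m m (h1 (0, x))) (\<lambda>x. normalize_m m (h1 (1, x)))"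
  proof (rule homotopic_sphere_m_normalize)
    show "continuous_on ({0..1::real} \<times> ?S) h1"
      unfolding h1_def
      by (intro continuous_on_coordinatewise_then_product continuous_on_add continuous_on_mult csnd
          continuous_on_product_then_coordinatewise[OF c1] continuous_on_diff continuous_on_const
          continuous_on_fst continuous_on_id)
    fix t :: real and x assume t: "t \<in> {0..1}" and x: "x \<in> ?S"
    have "h1 (t, x) \<in> Rm m"
      using F(2)[OF Rx[OF x, of "r x"]] S x by (auto simp: h1_def Rm_def)
    moreover have "h1 (t, x) \<noteq> (\<lambda>j. 0)"
    proof (cases "t = 1")
      case True
      then show ?thesis using nz[OF x, of 1] by (simp add: h1_def)
    next
      case False
      \<comment> \<open>Pairing with \<open>x\<close> separates the segment from the origin: the
        identity contributes \<open>1 - t\<close>, which is positive here, and the boundary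
        condition makes the other term nonnegative. The endpoint \<open>t = 1\<close> is where the
        assumed absence of zeros is used instead.\<close>
      have "inner_m m (h1 (t, x)) x = (1 - t) * inner_m m x x + t * inner_m m (F (\<lambda>j. r x * x j)) x"
        by (simp add: h1_def inner_m_def sum_distrib_left sum.distrib sum_subtractf algebra_simps)
      moreover have "t * inner_m m (F (\<lambda>j. r x * x j)) x \<ge> 0" using t bd[OF x] by simp
      ultimately have "inner_m m (h1 (t, x)) x > 0"
        using t False x by (simp add: sphere_m_def)
      then show ?thesis by (auto simp: inner_m_def)
    qed
    ultimately show "h1 (t, x) \<in> Rm m \<and> h1 (t, x) \<noteq> (\<lambda>j. 0)" by blast
  qed
  define h2 where "h2 y = F (\<lambda>j. (1 - fst y) * r (snd y) * snd y j)"
    for y :: "real \<times> (nat \<Rightarrow> real)"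
  have H2: "?hom (\<lambda>x. normalize_m m (h2 (0, x))) (\<lambda>x. normalize_m m (h2 (1, x)))"
  proof (rule homotopic_sphere_m_normalize)
    show "continuous_on ({0..1::real} \<times> ?S) h2"
      unfolding h2_def by (rule cF) (intro continuous_intros)
    fix t :: real and x assume "t \<in> {0..1}" and x: "x \<in> ?S"
    then show "h2 (t, x) \<in> Rm m \<and> h2 (t, x) \<noteq> (\<lambda>j. 0)"
      using nz[OF x, of "1 - t"] F(2)[OF Rx[OF x]] by (auto simp: h2_def)
  qed
  have e: "h1 (1, x) = h2 (0, x)" for x by (simp add: h1_def h2_def)
  have "?hom (\<lambda>x. normalize_m m (h1 (0, x))) (\<lambda>x. normalize_m m (h2 (1, x)))"
    by (rule homotopic_with_trans[OF H1[unfolded e] H2])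
  then have "?hom id (\<lambda>x. normalize_m m (F (\<lambda>j. 0)))"
    by (rule homotopic_with_eq) (auto simp: h1_def h2_def normalize_m_of_sphere)
  then have "contractible_space (nsphere (m - 1))"
    unfolding contractible_space_def top_of_set_sphere_m[OF m, symmetric] by blast
  then show False using non_contractible_space_nsphere by blast
qed

section \<open>The affine energy on finite-dimensional subspaces\<close>

text \<open>\<open>enn2real\<close> sends infinity to 0 and so is continuous only at finite values;
  hence the finiteness assumption on the limit.\<close>

lemma Lp_norm_tendsto:
  assumes "(\<lambda>k. Lp_int \<Omega> p (f k)) \<longlonglongrightarrow> Lp_int \<Omega> p g" "Lp_int \<Omega> p g < \<infinity>" "p > 0"
  shows "(\<lambda>k. Lp_norm \<Omega> p (f k)) \<longlonglongrightarrow> Lp_norm \<Omega> p g"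
proof -
  have "(\<lambda>k. Lp_int \<Omega> p (f k)) \<longlonglongrightarrow> ennreal (enn2real (Lp_int \<Omega> p g))"
    using assms by simp
  then have "(\<lambda>k. enn2real (Lp_int \<Omega> p (f k))) \<longlonglongrightarrow> enn2real (Lp_int \<Omega> p g)"
    by (rule tendsto_enn2real) simp
  then show ?thesis
    unfolding Lp_norm_def using assms(3) by (intro tendsto_powr' tendsto_const) auto
qed

lemma Lp_int_eq_0_iff:
  assumes "\<Omega> \<in> sets lebesgue" "f \<in> borel_measurable (lebesgue_on \<Omega>)"
  shows "Lp_int \<Omega> p f = 0 \<longleftrightarrow> (AE x in lebesgue_on \<Omega>. f x = 0)"
  unfolding Lp_int_eq[OF assms(1)] using assms(2)
  by (subst nn_integral_0_iff_AE) (auto simp: not_less)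

lemma Lp_norm_scale:
  assumes "\<Omega> \<in> sets lebesgue" "f \<in> borel_measurable (lebesgue_on \<Omega>)" "p > 0"
  shows "Lp_norm \<Omega> p (\<lambda>x. t * f x) = \<bar>t\<bar> * Lp_norm \<Omega> p f"
  using assms(3)
  by (simp add: Lp_norm_def Lp_int_scale[OF assms(1,2)] enn2real_mult powr_mult powr_powr)

lemma W_norm_AE_eq_0:
  assumes "W0_grad \<Omega> p u G" "bounded \<Omega>" "\<Omega> \<in> sets lebesgue" "p \<ge> 1"
    and "AE x in lebesgue_on \<Omega>. u x = 0"
  shows "W_norm \<Omega> p u = 0"
proof -
  note W = W0_grad_wgrad[OF assms(1)]
  have "AE x in lebesgue_on \<Omega>. norm (wgrad \<Omega> p u x) = 0"
    using W0_grad_AE_eq_0[OF W assms(2-5)] by simp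
  then have "Lp_int \<Omega> p u = 0" "Lp_int \<Omega> p (\<lambda>x. norm (wgrad \<Omega> p u x)) = 0"
    using assms(5) W0_grad_measurable[OF W assms(3)] by (simp_all add: Lp_int_eq_0_iff assms(3))
  then show ?thesis by (simp add: W_norm_def)
qed

lemma gamma_np_pos:
  assumes "n \<ge> 1" "p > 1" shows "gamma_np n p > 0"
proof -
  have "omega_vol k > 0" if "k \<ge> 0" for k
    using that by (simp add: omega_vol_def Gamma_real_pos)
  then have "omega_vol (real n + p - 2) > 0" "omega_vol (real n) > 0" "omega_vol (p - 1) > 0"
    using assms by auto
  then show ?thesis using assms by (auto simp: gamma_np_def intro!: mult_pos_pos)
qed

section \<open>Directional norms and the W-norm as functions of the coefficients\<close>

locale W0_basis =
  fixes \<Omega> :: "(real^'n) set" and p :: real and w :: "nat \<Rightarrow> real^'n \<Rightarrow> real" and m :: nat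
  assumes p: "p > 1" and bounded: "bounded \<Omega>" and open_\<Omega>: "open \<Omega>"
    and basis: "schauder_basis \<Omega> p w" and m: "m \<ge> 1"
begin

lemma meas_\<Omega>: "\<Omega> \<in> sets lebesgue"
  using open_\<Omega> by simp

lemma p0: "p > 0" and p1: "p \<ge> 1"
  using p by auto

text \<open>A representative of the gradient of the combination that is linear in the coefficients
  at every point, unlike \<open>wgrad\<close> of the combination, with which it agrees almost
  everywhere on \<Omega>.\<close>

definition grad_combo :: "(nat \<Rightarrow> real) \<Rightarrow> real^'n \<Rightarrow> real^'n" where
  "grad_combo \<zeta> x = (\<Sum>j<m. \<zeta> j *\<^sub>R wgrad \<Omega> p (w j) x)"

lemma W0_grad_basis: "W0_grad \<Omega> p (w j) (wgrad \<Omega> p (w j))"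
  using basis W0_grad_wgrad unfolding schauder_basis_def W0_def by blast

lemma W0_grad_combo: "W0_grad \<Omega> p (combo w m \<zeta>) (grad_combo \<zeta>)"
  unfolding combo_def grad_combo_def[abs_def]
  by (rule W0_grad_sum[OF W0_grad_basis meas_\<Omega> p0])

lemma combo_measurable: "combo w m \<zeta> \<in> borel_measurable (lebesgue_on \<Omega>)"
  and grad_combo_measurable [measurable]: "grad_combo \<zeta> \<in> borel_measurable (lebesgue_on \<Omega>)"
  using W0_grad_measurable[OF W0_grad_combo meas_\<Omega>] by auto

lemma wgrad_combo_AE: "AE x in lebesgue_on \<Omega>. wgrad \<Omega> p (combo w m \<zeta>) x = grad_combo \<zeta> x"
  by (rule W0_grad_unique[OF W0_grad_wgrad[OF W0_grad_combo] W0_grad_combo bounded meas_\<Omega> p1]) simp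

text \<open>The zero function is expanded both by the zero sequence and by \<zeta>: from index
  \<open>m\<close> on, the partial sums along \<zeta> are the given combination, whose W-norm is 0.
  Uniqueness in the Schauder property identifies the two sequences.\<close>

lemma combo_AE_eq_0_imp:
  assumes \<zeta>: "\<zeta> \<in> Rm m" and 0: "AE x in lebesgue_on \<Omega>. combo w m \<zeta> x = 0"
  shows "\<zeta> = (\<lambda>j. 0)"
proof -
  have z: "W0_grad \<Omega> p (\<lambda>x. 0) (\<lambda>x. 0)" by (rule W0_grad_zero)
  then have zW: "(\<lambda>x. 0) \<in> W0 \<Omega> p" unfolding W0_def by blast
  define P where "P c \<longleftrightarrow> (\<lambda>N. W_norm \<Omega> p (\<lambda>x. 0 - (\<Sum>j<N. c j * w j x))) \<longlonglongrightarrow> 0"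
    for c :: "nat \<Rightarrow> real"
  have uniq: "\<exists>!c. P c"
    unfolding P_def by (rule bspec[OF conjunct2[OF basis[unfolded schauder_basis_def]] zW])
  have "W_norm \<Omega> p (\<lambda>x. 0) = 0"
    by (rule W_norm_AE_eq_0[OF z bounded meas_\<Omega> p1]) simp
  then have c0: "P (\<lambda>j. 0)" by (simp add: P_def)
  have "W_norm \<Omega> p (\<lambda>x. 0 - (\<Sum>j<N. \<zeta> j * w j x)) = 0" if "N \<ge> m" for N
  proof -
    have "(\<Sum>j<N. \<zeta> j * w j x) = (\<Sum>j<m. \<zeta> j * w j x)" for x
      using \<zeta> that by (intro sum.mono_neutral_right) (auto simp: Rm_def)
    then have e: "(\<lambda>x. 0 - (\<Sum>j<N. \<zeta> j * w j x)) = combo w m (\<lambda>j. - \<zeta> j)"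
      by (simp add: combo_def sum_negf)
    have "AE x in lebesgue_on \<Omega>. combo w m (\<lambda>j. - \<zeta> j) x = 0"
      using 0 by (simp add: combo_def sum_negf)
    then show ?thesis
      unfolding e by (rule W_norm_AE_eq_0[OF W0_grad_combo bounded meas_\<Omega> p1])
  qed
  then have c1: "P \<zeta>"
    unfolding P_def by (intro tendsto_eventually) (auto simp: eventually_sequentially)
  show ?thesis using uniq c0 c1 by blast
qed

definition dir_norm :: "(nat \<Rightarrow> real) \<Rightarrow> real^'n \<Rightarrow> real" where
  "dir_norm \<zeta> \<xi> = Lp_norm \<Omega> p (\<lambda>x. grad_combo \<zeta> x \<bullet> \<xi>)"

lemma dir_norm_wgrad: "Lp_norm \<Omega> p (\<lambda>x. wgrad \<Omega> p (combo w m \<zeta>) x \<bullet> \<xi>) = dir_norm \<zeta> \<xi>"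
  unfolding dir_norm_def Lp_norm_def
  by (subst Lp_int_cong_AE[OF meas_\<Omega>, of _ "\<lambda>x. grad_combo \<zeta> x \<bullet> \<xi>"]) (use wgrad_combo_AE[of \<zeta>] in \<open>auto elim: eventually_mono\<close>)

lemma wgrad_basis_component:
  "(\<lambda>x. wgrad \<Omega> p (w j) x $ i) \<in> borel_measurable (lebesgue_on \<Omega>)"
  "Lp_int \<Omega> p (\<lambda>x. norm (wgrad \<Omega> p (w j) x $ i)) < \<infinity>"
proof -
  note [measurable] = W0_grad_measurable(2)[OF W0_grad_basis meas_\<Omega>]
  have "(\<lambda>x. wgrad \<Omega> p (w j) x \<bullet> axis i 1) \<in> borel_measurable (lebesgue_on \<Omega>)" by measurable
  then show m: "(\<lambda>x. wgrad \<Omega> p (w j) x $ i) \<in> borel_measurable (lebesgue_on \<Omega>)"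
    by (simp add: inner_axis)
  show "Lp_int \<Omega> p (\<lambda>x. norm (wgrad \<Omega> p (w j) x $ i)) < \<infinity>"
    by (rule Lp_int_add_finite[OF meas_\<Omega> p0, of 1 0 "\<lambda>x. norm (wgrad \<Omega> p (w j) x)" "\<lambda>x. 0"])
      (use W0_grad_basis[of j] component_le_norm_cart in \<open>auto simp: W0_grad_def\<close>)
qed

text \<open>The directional derivative is bilinear in \<zeta> and \<xi>. Written as one linear
  combination of the gradient components of the basis functions, with coefficients depending on
  both, it becomes jointly continuous by a single use of
  \<open>Lp_int_lincomb_tendsto\<close>.\<close>

lemma grad_combo_inner:
  "grad_combo \<zeta> x \<bullet> \<xi> = (\<Sum>q\<in>{..<m} \<times> UNIV. (\<zeta> (fst q) * \<xi> $ snd q) *\<^sub>R (wgrad \<Omega> p (w (fst q)) x $ snd q))"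
  unfolding grad_combo_def inner_sum_left
  by (simp add: inner_vec_def sum_distrib_left mult_ac sum.cartesian_product case_prod_unfold)

lemma
  assumes "\<And>j. j < m \<Longrightarrow> (\<lambda>k. \<zeta> k j) \<longlonglongrightarrow> \<eta> j" "\<xi> \<longlonglongrightarrow> \<nu>"
  shows dir_norm_finite: "Lp_int \<Omega> p (\<lambda>x. grad_combo \<eta> x \<bullet> \<nu>) < \<infinity>"
    and dir_norm_tendsto: "(\<lambda>k. dir_norm (\<zeta> k) (\<xi> k)) \<longlonglongrightarrow> dir_norm \<eta> \<nu>"
proof -
  let ?J = "{..<m} \<times> (UNIV :: 'n set)"
  let ?f = "\<lambda>q x. wgrad \<Omega> p (w (fst q)) x $ snd q"
  have c: "(\<lambda>k. \<zeta> k (fst q) * \<xi> k $ snd q) \<longlonglongrightarrow> \<eta> (fst q) * \<nu> $ snd q" if "q \<in> ?J" for q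
    using that assms by (intro tendsto_intros) auto
  have "finite ?J" by simp
  note L = Lp_int_lincomb_tendsto[OF this meas_\<Omega> p0, of ?f
      "\<lambda>k q. \<zeta> k (fst q) * \<xi> k $ snd q" "\<lambda>q. \<eta> (fst q) * \<nu> $ snd q",
      OF wgrad_basis_component c, folded grad_combo_inner]
  show fin: "Lp_int \<Omega> p (\<lambda>x. grad_combo \<eta> x \<bullet> \<nu>) < \<infinity>" using L(1) by simp
  show "(\<lambda>k. dir_norm (\<zeta> k) (\<xi> k)) \<longlonglongrightarrow> dir_norm \<eta> \<nu>"
    unfolding dir_norm_def using L(2) fin p0 by (intro Lp_norm_tendsto) (auto simp: case_prod_unfold)
qed

text \<open>A vanishing directional norm forces the combination itself to vanish, by Poincare's
  inequality in the direction \<xi>, and then linear independence forces \<zeta> to vanish. This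
  rules out the infinite branch of the integrand in \<open>affine_energy\<close> for every nonzero
  direction.\<close>

lemma dir_norm_pos:
  assumes "\<zeta> \<in> Rm m" "\<zeta> \<noteq> (\<lambda>j. 0)" "\<xi> \<noteq> 0" shows "dir_norm \<zeta> \<xi> > 0"
proof (rule ccontr)
  assume "\<not> ?thesis"
  then have "enn2real (Lp_int \<Omega> p (\<lambda>x. grad_combo \<zeta> x \<bullet> \<xi>)) = 0"
    by (simp add: dir_norm_def Lp_norm_def)
  \<comment> \<open>\<open>enn2real\<close> is also 0 at infinity; finiteness, obtained from
    constant sequences, excludes that reading.\<close>
  then have "Lp_int \<Omega> p (\<lambda>x. grad_combo \<zeta> x \<bullet> \<xi>) = 0"
    using dir_norm_finite[of "\<lambda>_. \<zeta>" \<zeta> "\<lambda>_. \<xi>" \<xi>] by (auto simp: enn2real_eq_0_iff)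
  then have "AE x in lebesgue_on \<Omega>. grad_combo \<zeta> x \<bullet> \<xi> = 0"
    by (subst (asm) Lp_int_eq_0_iff[OF meas_\<Omega>]) auto
  then have "AE x in lebesgue_on \<Omega>. combo w m \<zeta> x = 0"
    by (rule W0_grad_directional_AE_eq_0[OF W0_grad_combo bounded meas_\<Omega> p1 assms(3)])
  then show False using combo_AE_eq_0_imp assms by blast
qed

lemma dir_norm_scale: "dir_norm (\<lambda>j. t * \<zeta> j) \<xi> = \<bar>t\<bar> * dir_norm \<zeta> \<xi>"
proof -
  have "grad_combo (\<lambda>j. t * \<zeta> j) x \<bullet> \<xi> = t * (grad_combo \<zeta> x \<bullet> \<xi>)" for x
    by (simp add: grad_combo_def inner_sum_left sum_distrib_left mult_ac)
  then show ?thesis unfolding dir_norm_def by (simp add: Lp_norm_scale[OF meas_\<Omega> _ p0])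
qed

lemma norm_1pm_eq: "norm_1pm \<Omega> p w m \<zeta> = (enn2real (Lp_int \<Omega> p (combo w m \<zeta>))
    + enn2real (Lp_int \<Omega> p (\<lambda>x. norm (grad_combo \<zeta> x)))) powr (1 / p)"
  unfolding norm_1pm_def W_norm_def
  by (subst Lp_int_cong_AE[OF meas_\<Omega>, of "\<lambda>x. norm (wgrad \<Omega> p (combo w m \<zeta>) x)" "\<lambda>x. norm (grad_combo \<zeta> x)"])
    (use wgrad_combo_AE[of \<zeta>] in \<open>auto elim: eventually_mono\<close>)

lemma norm_1pm_tendsto:
  assumes c: "\<And>j. j < m \<Longrightarrow> (\<lambda>k. \<zeta> k j) \<longlonglongrightarrow> \<eta> j"
  shows "(\<lambda>k. norm_1pm \<Omega> p w m (\<zeta> k)) \<longlonglongrightarrow> norm_1pm \<Omega> p w m \<eta>"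
proof -
  note W = W0_grad_basis[unfolded W0_grad_def]
  have "Lp_int \<Omega> p (combo w m \<eta>) < \<infinity>"
    and l1: "(\<lambda>k. Lp_int \<Omega> p (combo w m (\<zeta> k))) \<longlonglongrightarrow> Lp_int \<Omega> p (combo w m \<eta>)"
    using Lp_int_lincomb_tendsto[of "{..<m}", OF _ meas_\<Omega> p0, of w \<zeta> \<eta>]
      W W0_grad_measurable(1)[OF W0_grad_basis meas_\<Omega>] c by (simp_all add: combo_def[abs_def])
  moreover have "Lp_int \<Omega> p (\<lambda>x. norm (grad_combo \<eta> x)) < \<infinity>"
    and "(\<lambda>k. Lp_int \<Omega> p (\<lambda>x. norm (grad_combo (\<zeta> k) x))) \<longlonglongrightarrow> Lp_int \<Omega> p (\<lambda>x. norm (grad_combo \<eta> x))"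
    using Lp_int_lincomb_tendsto[of "{..<m}", OF _ meas_\<Omega> p0, of "\<lambda>j. wgrad \<Omega> p (w j)" \<zeta> \<eta>]
      W W0_grad_measurable(2)[OF W0_grad_basis meas_\<Omega>] c by (simp_all add: grad_combo_def[abs_def])
  ultimately show ?thesis
    unfolding norm_1pm_eq using p0
    by (intro tendsto_powr' tendsto_const tendsto_add tendsto_enn2real) auto
qed

lemma norm_1pm_scale: "norm_1pm \<Omega> p w m (\<lambda>j. t * \<zeta> j) = \<bar>t\<bar> * norm_1pm \<Omega> p w m \<zeta>"
proof -
  have "combo w m (\<lambda>j. t * \<zeta> j) = (\<lambda>x. t * combo w m \<zeta> x)"
    by (simp add: combo_def sum_distrib_left mult_ac)
  then have 1: "Lp_int \<Omega> p (combo w m (\<lambda>j. t * \<zeta> j)) = ennreal (\<bar>t\<bar> powr p) * Lp_int \<Omega> p (combo w m \<zeta>)"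
    by (simp add: Lp_int_scale[OF meas_\<Omega> combo_measurable])
  have "norm (grad_combo (\<lambda>j. t * \<zeta> j) x) = \<bar>\<bar>t\<bar> * norm (grad_combo \<zeta> x)\<bar>" for x
    by (simp add: grad_combo_def abs_mult flip: scaleR_scaleR scaleR_sum_right)
  then have 2: "Lp_int \<Omega> p (\<lambda>x. norm (grad_combo (\<lambda>j. t * \<zeta> j) x))
      = ennreal (\<bar>t\<bar> powr p) * Lp_int \<Omega> p (\<lambda>x. norm (grad_combo \<zeta> x))"
    by (simp add: Lp_int_scale[OF meas_\<Omega>])
  show ?thesis
    unfolding norm_1pm_eq 1 2 using p0
    by (simp add: enn2real_mult powr_mult powr_powr flip: distrib_left)
qed

lemma norm_1pm_pos:
  assumes "\<zeta> \<in> Rm m" "\<zeta> \<noteq> (\<lambda>j. 0)" shows "norm_1pm \<Omega> p w m \<zeta> > 0"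
proof (rule ccontr)
  assume "\<not> ?thesis"
  then have "enn2real (Lp_int \<Omega> p (combo w m \<zeta>)) + enn2real (Lp_int \<Omega> p (\<lambda>x. norm (grad_combo \<zeta> x))) = 0"
    by (simp add: norm_1pm_eq)
  then have "enn2real (Lp_int \<Omega> p (combo w m \<zeta>)) = 0"
    using enn2real_nonneg by (metis add_nonneg_eq_0_iff)
  then have "Lp_int \<Omega> p (combo w m \<zeta>) = 0"
    using W0_grad_combo[of \<zeta>] by (auto simp: enn2real_eq_0_iff W0_grad_def)
  then show False
    using combo_AE_eq_0_imp assms by (simp add: Lp_int_eq_0_iff[OF meas_\<Omega> combo_measurable])
qed

end

section \<open>Uniform lower bounds and the integral over directions\<close>

lemma tendsto_fun_component:
  fixes u :: "nat \<Rightarrow> 'a \<Rightarrow> real"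
  assumes "u \<longlonglongrightarrow> a" shows "(\<lambda>k. u k j) \<longlonglongrightarrow> a j"
  using continuous_on_tendsto_compose[OF continuous_on_product_coordinates assms] by simp

lemma sphere_m_nonempty: "m \<ge> 1 \<Longrightarrow> sphere_m m \<noteq> {}"
proof -
  assume "m \<ge> 1"
  then have "(\<lambda>j. if j = 0 then 1 else 0) \<in> sphere_m m"
    by (auto simp: sphere_m_def Rm_def inner_m_def if_distrib cong: if_cong)
  then show ?thesis by blast
qed

lemma sphere_m_nonzero: "x \<in> sphere_m m \<Longrightarrow> x \<noteq> (\<lambda>j. 0)"
  by (auto simp: sphere_m_def inner_m_def)

lemma abs_component_le_inner_m:
  assumes "x \<in> Rm m" shows "\<bar>x j\<bar> \<le> sqrt (inner_m m x x)"
proof (cases "j < m")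
  case True
  then have "x j * x j \<le> inner_m m x x"
    unfolding inner_m_def by (intro member_le_sum) auto
  then show ?thesis by (intro real_le_rsqrt) (simp add: power2_eq_square)
next
  case False
  then show ?thesis using assms inner_m_self_nonneg[of m x] by (simp add: Rm_def)
qed

lemma AE_lebesgue_neq: "AE x in lebesgue. x \<noteq> (a :: 'a::euclidean_space)"
proof -
  have "{a} \<in> null_sets lebesgue" by (simp add: negligible_sing flip: negligible_iff_null_sets)
  from AE_not_in[OF this] show ?thesis by simp
qed

lemma sets_lebesgue_ball [measurable]: "ball a r \<in> sets lebesgue" for a :: "'a::euclidean_space"
  by simp

context W0_basis
begin

text \<open>Joint continuity lets the minimum be taken over the product of the two unit spheres at
  once, so one constant serves all coefficients and all directions.\<close>

lemma dir_norm_lower_bound: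
  obtains c where "c > 0" "\<And>\<zeta> \<xi>. \<zeta> \<in> sphere_m m \<Longrightarrow> norm \<xi> = 1 \<Longrightarrow> c \<le> dir_norm \<zeta> \<xi>"
proof -
  let ?K = "sphere_m m \<times> sphere (0::real^'n) 1"
  have "continuous_on ?K (\<lambda>y. dir_norm (fst y) (snd y))"
  proof (rule continuous_on_sequentiallyI)
    fix u a assume u: "u \<longlonglongrightarrow> (a :: (nat \<Rightarrow> real) \<times> (real^'n))"
    then show "(\<lambda>k. dir_norm (fst (u k)) (snd (u k))) \<longlonglongrightarrow> dir_norm (fst a) (snd a)"
      by (intro dir_norm_tendsto tendsto_fun_component tendsto_fst tendsto_snd)
  qed
  moreover have "compact ?K" by (intro compact_Times compact_sphere_m) simp
  moreover have "?K \<noteq> {}"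
    using sphere_m_nonempty[OF m] by simp
  ultimately obtain y where y: "y \<in> ?K" "\<And>z. z \<in> ?K \<Longrightarrow> dir_norm (fst y) (snd y) \<le> dir_norm (fst z) (snd z)"
    using continuous_attains_inf[of ?K "\<lambda>y. dir_norm (fst y) (snd y)"] by blast
  have "dir_norm (fst y) (snd y) > 0"
    using y(1) by (intro dir_norm_pos) (auto simp: sphere_m_nonzero sphere_m_def[of m] inner_m_def)
  moreover have "dir_norm (fst y) (snd y) \<le> dir_norm \<zeta> \<xi>" if "\<zeta> \<in> sphere_m m" "norm \<xi> = 1" for \<zeta> \<xi>
    using y(2)[of "(\<zeta>, \<xi>)"] that by simp
  ultimately show ?thesis using that by blast
qed

text \<open>The half of the equivalence of norms on a finite-dimensional space that turns smallness
  in \<open>norm_1pm\<close> into smallness of every coordinate; the other half is contained in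
  \<open>norm_1pm_tendsto\<close>.\<close>

lemma norm_1pm_lower_bound:
  obtains c where "c > 0" "\<And>\<zeta>. \<zeta> \<in> Rm m \<Longrightarrow> c * sqrt (inner_m m \<zeta> \<zeta>) \<le> norm_1pm \<Omega> p w m \<zeta>"
proof -
  have "continuous_on (sphere_m m) (norm_1pm \<Omega> p w m)"
    by (rule continuous_on_sequentiallyI) (intro norm_1pm_tendsto tendsto_fun_component)
  then obtain y where y: "y \<in> sphere_m m"
    "\<And>z. z \<in> sphere_m m \<Longrightarrow> norm_1pm \<Omega> p w m y \<le> norm_1pm \<Omega> p w m z"
    using continuous_attains_inf[OF compact_sphere_m sphere_m_nonempty[OF m]] by blast
  have "norm_1pm \<Omega> p w m y > 0"
    using y(1) by (intro norm_1pm_pos sphere_m_nonzero) (auto simp: sphere_m_def)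
  moreover have "norm_1pm \<Omega> p w m y * sqrt (inner_m m \<zeta> \<zeta>) \<le> norm_1pm \<Omega> p w m \<zeta>"
    if \<zeta>: "\<zeta> \<in> Rm m" for \<zeta>
  proof (cases "\<zeta> = (\<lambda>j. 0)")
    case True
    then show ?thesis by (simp add: inner_m_def norm_1pm_def W_norm_def)
  next
    case False
    let ?s = "sqrt (inner_m m \<zeta> \<zeta>)"
    have s: "?s > 0"
      using False \<zeta> inner_m_self_eq_0[OF \<zeta>] inner_m_self_nonneg[of m \<zeta>] by (auto simp: order_le_less)
    then have "norm_1pm \<Omega> p w m (\<lambda>j. ?s * normalize_m m \<zeta> j) = norm_1pm \<Omega> p w m \<zeta>"
      by (simp add: normalize_m_def)
    then have "norm_1pm \<Omega> p w m \<zeta> = ?s * norm_1pm \<Omega> p w m (normalize_m m \<zeta>)"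
      using s by (simp add: norm_1pm_scale)
    moreover have "norm_1pm \<Omega> p w m y \<le> norm_1pm \<Omega> p w m (normalize_m m \<zeta>)"
      by (intro y(2) normalize_m_sphere \<zeta> False)
    ultimately show ?thesis using s by (simp add: mult.commute)
  qed
  ultimately show ?thesis using that by blast
qed

text \<open>The integral inside \<open>affine_energy\<close>, with the linear representative of the
  gradient and without the branch for a vanishing directional norm. For \<zeta> on the unit sphere
  the two integrands differ at most at the origin.\<close>

definition polar_integral :: "(nat \<Rightarrow> real) \<Rightarrow> ennreal" where
  "polar_integral \<zeta> = ennreal (real CARD('n)) *
     (\<integral>\<^sup>+x\<in>ball 0 1. ennreal (dir_norm \<zeta> (x /\<^sub>R norm x) powr (- real CARD('n))) \<partial>lebesgue)"

lemma dir_norm_radial_measurable [measurable]: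
  "(\<lambda>x. dir_norm \<zeta> (x /\<^sub>R norm x)) \<in> borel_measurable lebesgue"
proof -
  have "continuous_on UNIV (dir_norm \<zeta>)"
    by (rule continuous_on_sequentiallyI) (intro dir_norm_tendsto tendsto_const)
  then have [measurable]: "dir_norm \<zeta> \<in> borel_measurable borel"
    by (rule borel_measurable_continuous_onI)
  have "(\<lambda>x. dir_norm \<zeta> (x /\<^sub>R norm x)) \<in> borel_measurable borel" by measurable
  then show ?thesis by (intro measurable_completion) simp
qed

text \<open>The lower bound \<open>c\<close> on the directional norms bounds the negative power by
  the constant \<open>c powr (- ?n)\<close>, which is integrable over the unit ball. This gives
  finiteness, and continuity by dominated convergence.\<close>

lemma
  assumes "\<eta> \<in> sphere_m m"
  shows polar_integral_finite: "polar_integral \<eta> < \<infinity>"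
    and polar_integral_tendsto: "(\<And>k. \<zeta> k \<in> sphere_m m) \<Longrightarrow> \<zeta> \<longlonglongrightarrow> \<eta> \<Longrightarrow>
      (\<lambda>k. polar_integral (\<zeta> k)) \<longlonglongrightarrow> polar_integral \<eta>"
proof -
  let ?n = "real CARD('n)"
  obtain c where c: "c > 0" "\<And>\<zeta> \<xi>. \<zeta> \<in> sphere_m m \<Longrightarrow> norm \<xi> = 1 \<Longrightarrow> c \<le> dir_norm \<zeta> \<xi>"
    using dir_norm_lower_bound by blast
  let ?b = "\<lambda>x::real^'n. ennreal (c powr (- ?n)) * indicator (ball 0 1) x"
  let ?f = "\<lambda>\<zeta> x. ennreal (dir_norm \<zeta> (x /\<^sub>R norm x) powr (- ?n)) * indicator (ball 0 1) x"
  have bfin: "(\<integral>\<^sup>+x. ?b x \<partial>lebesgue) < \<infinity>"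
    using emeasure_lborel_ball_finite[of "0::real^'n" 1]
    by (simp add: nn_integral_cmult_indicator ennreal_mult_less_top)
  have bd: "AE x in lebesgue. ?f \<zeta> x \<le> ?b x" if "\<zeta> \<in> sphere_m m" for \<zeta>
    using AE_lebesgue_neq[of "0::real^'n"]
  proof eventually_elim
    case (elim x)
    then have "c \<le> dir_norm \<zeta> (x /\<^sub>R norm x)" by (intro c(2) that) simp
    then have "dir_norm \<zeta> (x /\<^sub>R norm x) powr (- ?n) \<le> c powr (- ?n)"
      using c(1) by (intro powr_mono2') auto
    then show ?case by (intro mult_right_mono ennreal_leI) auto
  qed
  have "(\<integral>\<^sup>+x. ?f \<eta> x \<partial>lebesgue) < \<infinity>"
    by (rule le_less_trans[OF nn_integral_mono_AE[OF bd[OF assms]] bfin])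
  then show "polar_integral \<eta> < \<infinity>"
    unfolding polar_integral_def by (simp add: ennreal_mult_less_top)
  assume \<zeta>: "\<And>k. \<zeta> k \<in> sphere_m m" "\<zeta> \<longlonglongrightarrow> \<eta>"
  have "(\<lambda>k. \<integral>\<^sup>+x. ?f (\<zeta> k) x \<partial>lebesgue) \<longlonglongrightarrow> (\<integral>\<^sup>+x. ?f \<eta> x \<partial>lebesgue)"
  proof (rule nn_integral_dominated_convergence[where w = ?b])
    show "AE x in lebesgue. (\<lambda>k. ?f (\<zeta> k) x) \<longlonglongrightarrow> ?f \<eta> x"
      using AE_lebesgue_neq[of "0::real^'n"]
    proof eventually_elim
      case (elim x)
      \<comment> \<open>A negative power is continuous only away from 0, so the limit must be known
        to be nonzero.\<close>
      then have "dir_norm \<eta> (x /\<^sub>R norm x) \<noteq> 0" using c(1) c(2)[OF assms, of "x /\<^sub>R norm x"] by auto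
      moreover have "(\<lambda>k. dir_norm (\<zeta> k) (x /\<^sub>R norm x)) \<longlonglongrightarrow> dir_norm \<eta> (x /\<^sub>R norm x)"
        by (intro dir_norm_tendsto tendsto_fun_component \<zeta> tendsto_const)
      ultimately have "(\<lambda>k. ennreal (dir_norm (\<zeta> k) (x /\<^sub>R norm x) powr (- ?n)))
          \<longlonglongrightarrow> ennreal (dir_norm \<eta> (x /\<^sub>R norm x) powr (- ?n))"
        by (intro tendsto_ennrealI tendsto_powr tendsto_const)
      then show ?case by (cases "x \<in> ball 0 1") (simp_all del: mem_ball)
    qed
    show "AE x in lebesgue. ?f (\<zeta> k) x \<le> ?b x" for k by (rule bd[OF \<zeta>(1)])
    show "(\<integral>\<^sup>+x. ?b x \<partial>lebesgue) < \<infinity>" by (rule bfin)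
  qed measurable
  then show "(\<lambda>k. polar_integral (\<zeta> k)) \<longlonglongrightarrow> polar_integral \<eta>"
    unfolding polar_integral_def by (intro tendsto_mult_ennreal tendsto_const) auto
qed

text \<open>The directional norms are finite real numbers, so their negative powers are positive
  almost everywhere on the ball. A zero integral would make the energy 0 as well, since
  \<open>powr\<close> is 0 at base 0.\<close>

lemma polar_integral_pos:
  assumes "\<zeta> \<in> sphere_m m" shows "polar_integral \<zeta> \<noteq> 0"
proof
  assume "polar_integral \<zeta> = 0"
  then have "(\<integral>\<^sup>+x. ennreal (dir_norm \<zeta> (x /\<^sub>R norm x) powr (- real CARD('n))) * indicator (ball 0 1) x \<partial>lebesgue) = 0"
    by (simp add: polar_integral_def)
  then have "AE x in lebesgue. ennreal (dir_norm \<zeta> (x /\<^sub>R norm x) powr (- real CARD('n))) * indicator (ball 0 1) x = 0"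
    by (subst (asm) nn_integral_0_iff_AE) measurable
  then have "AE x in lebesgue. x \<notin> ball (0::real^'n) 1"
    using AE_lebesgue_neq[of 0]
  proof eventually_elim
    case (elim x)
    have "dir_norm \<zeta> (x /\<^sub>R norm x) > 0"
      using elim assms by (intro dir_norm_pos sphere_m_nonzero) (auto simp: sphere_m_def)
    then show ?case using elim by (auto simp: indicator_def split: if_splits)
  qed
  then have "negligible (ball (0::real^'n) 1)"
    by (subst (asm) AE_iff_null_sets[symmetric]) (auto simp: negligible_iff_null_sets)
  then show False using open_not_negligible[of "ball (0::real^'n) 1"] by simp
qed

text \<open>The affine energy on the Euclidean unit sphere of coefficients. By homogeneity its
  reciprocal, times the radius, is the radial function of the affine ball.\<close>

definition sphere_energy :: "(nat \<Rightarrow> real) \<Rightarrow> real" where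
  "sphere_energy \<zeta> = gamma_np CARD('n) p * enn2real (polar_integral \<zeta>) powr (- 1 / real CARD('n))"

lemma enn2real_polar_integral_pos:
  assumes "\<zeta> \<in> sphere_m m" shows "enn2real (polar_integral \<zeta>) > 0"
  using polar_integral_finite[OF assms] polar_integral_pos[OF assms]
  by (simp add: enn2real_positive_iff zero_less_iff_neq_zero)

lemma sphere_energy_pos: "\<zeta> \<in> sphere_m m \<Longrightarrow> sphere_energy \<zeta> > 0"
  unfolding sphere_energy_def using enn2real_polar_integral_pos[of \<zeta>] gamma_np_pos[OF _ p, of "CARD('n)"]
  by (auto intro!: mult_pos_pos)

lemma sphere_energy_continuous: "continuous_on (sphere_m m) sphere_energy"
proof (rule continuous_on_sequentiallyI)
  fix u a assume u: "\<forall>k. u k \<in> sphere_m m" "a \<in> sphere_m m" "u \<longlonglongrightarrow> a"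
  have "(\<lambda>k. polar_integral (u k)) \<longlonglongrightarrow> ennreal (enn2real (polar_integral a))"
    using polar_integral_tendsto[OF u(2) _ u(3)] u(1) polar_integral_finite[OF u(2)] by simp
  then have "(\<lambda>k. enn2real (polar_integral (u k))) \<longlonglongrightarrow> enn2real (polar_integral a)"
    by (rule tendsto_enn2real) simp
  then show "(\<lambda>k. sphere_energy (u k)) \<longlonglongrightarrow> sphere_energy a"
    unfolding sphere_energy_def using enn2real_polar_integral_pos[OF u(2)]
    by (intro tendsto_mult tendsto_const tendsto_powr) auto
qed

text \<open>Scaling by \<open>t\<close> multiplies the directional norms by \<open>t\<close>, the
  integral by the power of \<open>t\<close> with exponent minus the dimension, and the outer
  exponent turns this back into \<open>t\<close>. For positive \<open>t\<close> both exceptional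
  branches of \<open>affine_energy\<close> have to be excluded: the combination is not the zero
  function, and the integral is finite. For \<open>t = 0\<close> the value 0 comes from the first
  branch.\<close>

lemma affine_floor_scale:
  assumes \<zeta>: "\<zeta> \<in> sphere_m m" and t: "t \<ge> 0"
  shows "affine_floor \<Omega> p w m (\<lambda>j. t * \<zeta> j) = t * sphere_energy \<zeta>"
proof (cases "t = 0")
  case True
  then show ?thesis by (simp add: affine_floor_def combo_def affine_energy_def)
next
  case False
  then have t0: "t > 0" using t by simp
  let ?n = "real CARD('n)" and ?z = "\<lambda>j. t * \<zeta> j"
  have zR: "?z \<in> Rm m" "?z \<noteq> (\<lambda>j. 0)"
    using \<zeta> t0 sphere_m_nonzero[OF \<zeta>] by (auto simp: sphere_m_def Rm_def fun_eq_iff)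
  have nz: "combo w m ?z \<noteq> (\<lambda>x. 0)"
    using combo_AE_eq_0_imp[OF zR(1)] zR(2) by auto
  define I where "I = sphere_nn_integral (\<lambda>\<xi>::real^'n.
      let a = Lp_norm \<Omega> p (\<lambda>x. wgrad \<Omega> p (combo w m ?z) x \<bullet> \<xi>)
      in if a = 0 then \<infinity> else ennreal (a powr (- ?n)))"
  have I: "I = ennreal (t powr (- ?n)) * polar_integral \<zeta>"
  proof -
    have "I = ennreal ?n * (\<integral>\<^sup>+x. ennreal (t powr (- ?n)) *
        (ennreal (dir_norm \<zeta> (x /\<^sub>R norm x) powr (- ?n)) * indicator (ball 0 1) x) \<partial>lebesgue)"
      unfolding I_def sphere_nn_integral_def dir_norm_wgrad Let_def
    proof (intro arg_cong2[of _ _ _ _ "(*)"] refl nn_integral_cong_AE)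
      \<comment> \<open>At the origin \<open>x /\<^sub>R norm x\<close> is 0 and the left integrand
        is infinite while the right one is 0, so equality holds only almost everywhere.\<close>
      show "AE x in lebesgue. (if dir_norm ?z (x /\<^sub>R norm x) = 0 then \<infinity>
              else ennreal (dir_norm ?z (x /\<^sub>R norm x) powr - ?n)) * indicator (ball 0 1) x =
             ennreal (t powr - ?n) * (ennreal (dir_norm \<zeta> (x /\<^sub>R norm x) powr - ?n) * indicator (ball 0 1) x)"
        using AE_lebesgue_neq[of "0::real^'n"]
      proof eventually_elim
        case (elim x)
        have "dir_norm \<zeta> (x /\<^sub>R norm x) > 0"
          using elim \<zeta> by (intro dir_norm_pos sphere_m_nonzero) (auto simp: sphere_m_def)
        then show ?case
          using t0 by (simp add: dir_norm_scale powr_mult ennreal_mult' mult.assoc)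
      qed
    qed
    also have "\<dots> = ennreal (t powr (- ?n)) * polar_integral \<zeta>"
      unfolding polar_integral_def by (subst nn_integral_cmult) (measurable, simp add: mult_ac)
    finally show ?thesis .
  qed
  have "I \<noteq> \<infinity>" using polar_integral_finite[OF \<zeta>] by (auto simp: I ennreal_mult_eq_top_iff)
  then have "affine_floor \<Omega> p w m ?z = gamma_np CARD('n) p * enn2real I powr (- 1 / ?n)"
    unfolding affine_floor_def affine_energy_def I_def[symmetric] using nz by (simp add: Let_def)
  also have "enn2real I powr (- 1 / ?n) = t * enn2real (polar_integral \<zeta>) powr (- 1 / ?n)"
    using t0 by (simp add: I enn2real_mult powr_mult powr_powr)
  finally show ?thesis by (simp add: sphere_energy_def)
qed

text \<open>Continuity in the metric of \<open>norm_1pm\<close> is translated into the product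
  topology used by the topological argument: coordinatewise convergence of the arguments makes their
  W-norm distance small, and smallness of the W-norm distance of the images controls each
  coordinate.\<close>

lemma continuous_on_Rm_if_norm_1pm_continuous:
  assumes F: "\<And>\<zeta>. \<zeta> \<in> Rm m \<Longrightarrow> F \<zeta> \<in> Rm m"
    and cont: "\<forall>\<zeta>\<in>Rm m. \<forall>\<epsilon>>0. \<exists>\<delta>>0. \<forall>\<eta>\<in>Rm m.
           norm_1pm \<Omega> p w m (\<lambda>j. \<eta> j - \<zeta> j) < \<delta> \<longrightarrow>
           norm_1pm \<Omega> p w m (\<lambda>j. F \<eta> j - F \<zeta> j) < \<epsilon>"
  shows "continuous_on (Rm m) F"
proof (intro continuous_on_coordinatewise_then_product continuous_on_sequentiallyI)
  fix u a and j :: nat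
  assume u: "\<forall>k. u k \<in> Rm m" "a \<in> Rm m" "u \<longlonglongrightarrow> a"
  obtain c where c: "c > 0" "\<And>\<zeta>. \<zeta> \<in> Rm m \<Longrightarrow> c * sqrt (inner_m m \<zeta> \<zeta>) \<le> norm_1pm \<Omega> p w m \<zeta>"
    using norm_1pm_lower_bound by blast
  have diff: "(\<lambda>j. x j - y j) \<in> Rm m" if "x \<in> Rm m" "y \<in> Rm m" for x y
    using that by (simp add: Rm_def)
  have "(\<lambda>k. norm_1pm \<Omega> p w m (\<lambda>j. u k j - a j)) \<longlonglongrightarrow> norm_1pm \<Omega> p w m (\<lambda>j. a j - a j)"
    by (intro norm_1pm_tendsto tendsto_diff tendsto_fun_component u tendsto_const)
  also have "norm_1pm \<Omega> p w m (\<lambda>j. a j - a j) = 0"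
    using norm_1pm_scale[of 0 a] by simp
  finally have lim: "(\<lambda>k. norm_1pm \<Omega> p w m (\<lambda>j. u k j - a j)) \<longlonglongrightarrow> 0" .
  show "(\<lambda>k. F (u k) j) \<longlonglongrightarrow> F a j"
  proof (rule metric_LIMSEQ_I)
    fix e :: real assume "e > 0"
    \<comment> \<open>The tolerance is \<open>c * e\<close> because \<open>c\<close> times the
      modulus of a coordinate is at most the W-norm; dividing by \<open>c\<close> at the end leaves
      \<open>e\<close>.\<close>
    then have "c * e > 0" using c(1) by simp
    then obtain d where d: "d > 0" "\<forall>\<eta>\<in>Rm m. norm_1pm \<Omega> p w m (\<lambda>j. \<eta> j - a j) < d \<longrightarrow>
           norm_1pm \<Omega> p w m (\<lambda>j. F \<eta> j - F a j) < c * e"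
      using cont u(2) by blast
    have "\<forall>\<^sub>F k in sequentially. norm_1pm \<Omega> p w m (\<lambda>j. u k j - a j) < d"
      using lim d(1) by (rule order_tendstoD)
    then obtain N where N: "\<And>k. k \<ge> N \<Longrightarrow> norm_1pm \<Omega> p w m (\<lambda>j. u k j - a j) < d"
      by (auto simp: eventually_sequentially)
    have "dist (F (u k) j) (F a j) < e" if "k \<ge> N" for k
    proof -
      have R: "(\<lambda>j. F (u k) j - F a j) \<in> Rm m" using u F diff by simp
      have "c * \<bar>F (u k) j - F a j\<bar>
          \<le> c * sqrt (inner_m m (\<lambda>j. F (u k) j - F a j) (\<lambda>j. F (u k) j - F a j))"
        using abs_component_le_inner_m[OF R, of j] c(1) by (intro mult_left_mono) auto
      also have "\<dots> \<le> norm_1pm \<Omega> p w m (\<lambda>j. F (u k) j - F a j)" by (rule c(2)[OF R])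
      also have "\<dots> < c * e" using d(2) u(1) N[OF that] by blast
      finally show ?thesis using c(1) by (simp add: dist_real_def)
    qed
    then show "\<exists>N. \<forall>k\<ge>N. dist (F (u k) j) (F a j) < e" by blast
  qed
qed

end

section \<open>The closed affine ball as a star body\<close>

theorem theorem1p1:
  fixes \<Omega> :: "(real^'n) set" and p \<rho> :: real and m :: nat
    and w :: "nat \<Rightarrow> real^'n \<Rightarrow> real" and F :: "(nat \<Rightarrow> real) \<Rightarrow> (nat \<Rightarrow> real)"
  assumes "CARD('n) \<ge> 2" and "p > 1"
    and "bounded \<Omega>" and "open \<Omega>"
    and "schauder_basis \<Omega> p w"
    and "m \<ge> 1"
    and "\<forall>\<zeta>\<in>Rm m. F \<zeta> \<in> Rm m"
    and "\<forall>\<zeta>\<in>Rm m. \<forall>\<epsilon>>0. \<exists>\<delta>>0. \<forall>\<eta>\<in>Rm m.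
           norm_1pm \<Omega> p w m (\<lambda>j. \<eta> j - \<zeta> j) < \<delta> \<longrightarrow>
           norm_1pm \<Omega> p w m (\<lambda>j. F \<eta> j - F \<zeta> j) < \<epsilon>"
    and "\<rho> > 0"
    and "\<forall>\<zeta>\<in>Rm m. affine_floor \<Omega> p w m \<zeta> = \<rho> \<longrightarrow> inner_m m (F \<zeta>) \<zeta> \<ge> 0"
  shows "\<exists>z0\<in>Rm m. affine_floor \<Omega> p w m z0 \<le> \<rho> \<and> F z0 = (\<lambda>j. 0)"
proof -
  interpret W0_basis \<Omega> p w m by unfold_locales (use assms in auto)
  \<comment> \<open>By homogeneity of the energy, the ray through \<open>x\<close> meets the level
    set of value \<rho> exactly at this multiple of \<open>x\<close>.\<close>
  let ?r = "\<lambda>x. \<rho> / sphere_energy x"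
  have S: "(\<lambda>j. s * x j) \<in> Rm m" if "x \<in> sphere_m m" for x s
    using that by (auto simp: sphere_m_def Rm_def)
  have r_pos: "?r x > 0" if "x \<in> sphere_m m" for x
    using sphere_energy_pos[OF that] assms(9) by simp
  have floor: "affine_floor \<Omega> p w m (\<lambda>j. t * ?r x * x j) = t * \<rho>" if "x \<in> sphere_m m" "t \<ge> 0" for x t
  proof -
    have "t * ?r x \<ge> 0" using r_pos[OF that(1)] that(2) by (intro mult_nonneg_nonneg) auto
    from affine_floor_scale[OF that(1) this] show ?thesis
      using sphere_energy_pos[OF that(1)] by simp
  qed
  have "\<exists>x\<in>sphere_m m. \<exists>t\<in>{0..1}. F (\<lambda>j. t * ?r x * x j) = (\<lambda>j. 0)"
  proof (rule exists_zero_on_star_body[OF m])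
    show "continuous_on (Rm m) F"
      using assms(7) by (intro continuous_on_Rm_if_norm_1pm_continuous assms(8)) blast
    show "F x \<in> Rm m" if "x \<in> Rm m" for x using that assms(7) by blast
    show "continuous_on (sphere_m m) ?r"
      using sphere_energy_pos
      by (intro continuous_on_divide continuous_on_const sphere_energy_continuous) force
    fix x assume x: "x \<in> sphere_m m"
    have "affine_floor \<Omega> p w m (\<lambda>j. ?r x * x j) = \<rho>" using floor[OF x, of 1] by simp
    then have "inner_m m (F (\<lambda>j. ?r x * x j)) (\<lambda>j. ?r x * x j) \<ge> 0"
      using assms(10) S[OF x, of "?r x"] by blast
    \<comment> \<open>The hypothesis pairs \<open>F\<close> with the boundary point, which is a
      positive multiple of \<open>x\<close>; dividing by the factor gives the sign condition at the
      unit vector.\<close>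
    then have "?r x * inner_m m (F (\<lambda>j. ?r x * x j)) x \<ge> 0"
      using inner_m_scale[of m 1 "F (\<lambda>j. ?r x * x j)" "?r x" x] by simp
    then show "inner_m m (F (\<lambda>j. ?r x * x j)) x \<ge> 0"
      using r_pos[OF x] by (meson mult_pos_neg not_le)
  qed
  then obtain x t where xt: "x \<in> sphere_m m" "t \<in> {0..1}" "F (\<lambda>j. t * ?r x * x j) = (\<lambda>j. 0)"
    by blast
  show ?thesis
  proof (intro bexI conjI)
    \<comment> \<open>The zero lies at the fraction \<open>t\<close> of the way to the boundary,
      where the energy is \<open>t * \<rho>\<close>.\<close>
    show "affine_floor \<Omega> p w m (\<lambda>j. t * ?r x * x j) \<le> \<rho>"
      using floor[OF xt(1), of t] xt(2) assms(9) by (simp add: mult_left_le_one_le)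
    show "(\<lambda>j. t * ?r x * x j) \<in> Rm m" by (rule S[OF xt(1)])
  qed (rule xt(3))
qed

end
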